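(* Let $a$ and $b$ be relatively prime positive integers, let $i,j,m,n\in\{0,1\}$ with $(i,j)\neq(0,0)$ and $(m,n)\neq(0,0)$, let $\tau\in\mathcal{D}$, and let $N\ge 0$ be an integer. If $ia+mb$ is odd or $ja+nb$ is odd, then $$ \begin{aligned} & \frac{1}{(2N)!}\frac{1}{a}\sum_{\substack{\mu,\nu =0 \\ (\mu,\nu) \neq(0,0)}}^{a-1}(-1)^{i\mu +j\nu } f_{m,n}\left(b\frac{\mu \tau +\nu}{a},\tau \right)f_{ia+mb,\,ja+nb}^{(2N)}\left(\frac{\mu \tau +\nu}{a},\tau \right) \\ & \quad +\frac{1}{(2N)!}\frac{1}{b}\sum_{\substack{\mu,\nu =0 \\ (\mu,\nu) \neq(0,0)}}^{b-1}(-1)^{m\mu +n\nu } f_{i,j}\left(a\frac{\mu \tau +\nu}{b},\tau \right)f_{ia+mb,\,ja+nb}^{(2N)}\left(\frac{\mu \tau +\nu}{b},\tau \right) \\ & = -\sum_{s=0}^{N+1}C_{i,j}(s,\tau )\,C_{m,n}(N+1-s,\tau )\,a^{2s-1}b^{2N+1-2s} -\frac{1}{ab}(2N+1)\,C_{ia+mb,\,ja+nb}(N+1, \tau ). \end{aligned} $$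
   Context: Let $\mathfrak{H}=\{\tau\in\mathbb{C}\mid \operatorname{Im}\tau>0\}$ and $\mathcal{D}=\{\tau\in\mathfrak{H} \mid |\operatorname{Re}\tau|\le 1,\ |\tau\pm\frac12|\ge\frac12\}$ (the fundamental domain of $\Gamma(2)$ to which $\tau$ is restricted throughout). Write $q^{x}:=e^{2\pi\sqrt{-1}\,x\tau}$ for real $x$. The Jacobi theta functions are $$\theta_1(z,\tau)=2\sum_{n=0}^\infty(-1)^n q^{\frac12(n+\frac12)^2}\sin((2n+1)\pi z),\qquad \theta_2(z,\tau)=2\sum_{n=0}^\infty q^{\frac12(n+\frac12)^2}\cos((2n+1)\pi z),$$ $$\theta_3(z,\tau)=1+2\sum_{n=1}^\infty q^{\frac12 n^2}\cos(2n\pi z),\qquad \theta_4(z,\tau)=1+2\sum_{n=1}^\infty(-1)^n q^{\frac12 n^2}\cos(2n\pi z).$$ Put $k=k(\tau)=\theta_2(0,\tau)^2/\theta_3(0,\tau)^2$ and $K=K(\tau)=\frac{\pi}{2}\theta_3(0,\tau)^2$. The Jacobi elliptic functions are $$\mathrm{sn}(2Kz,k)=\frac{\theta_3(0,\tau)}{\theta_2(0,\tau)}\frac{\theta_1(z,\tau)}{\theta_4(z,\tau)},\quad \mathrm{cn}(2Kz,k)=\frac{\theta_4(0,\tau)}{\theta_2(0,\tau)}\frac{\theta_2(z,\tau)}{\theta_4(z,\tau)},\quad \mathrm{dn}(2Kz,k)=\frac{\theta_4(0,\tau)}{\theta_3(0,\tau)}\frac{\theta_3(z,\tau)}{\theta_4(z,\tau)},$$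 and $\mathrm{cs}=\mathrm{cn}/\mathrm{sn}$, $\mathrm{ds}=\mathrm{dn}/\mathrm{sn}$, $\mathrm{ns}=1/\mathrm{sn}$. Define $$f_{1,0}(z,\tau):=2K\,\mathrm{cs}(2Kz,k),\qquad f_{1,1}(z,\tau):=2K\,\mathrm{ds}(2Kz,k),\qquad f_{0,1}(z,\tau):=2K\,\mathrm{ns}(2Kz,k).$$ The indices of $f$ (and of $C$ below) are regarded as elements of $\mathbb{Z}/2\mathbb{Z}$ (i.e. reduced mod 2); $f_{0,0}$ is not defined. $f_{i,j}^{(2N)}(z,\tau)$ denotes the $2N$-th derivative of $f_{i,j}(z,\tau)$ with respect to $z$. The numbers $C_{i,j}(s,\tau)$, $s\ge 0$, are the coefficients of the Laurent expansion at $z=0$: $$f_{i,j}(z,\tau)=\frac1z\sum_{s=0}^\infty C_{i,j}(s,\tau)z^{2s},\qquad C_{i,j}(0,\tau)=1.$$ Empty sums (when $a=1$ or $b=1$) are $0$. *)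

theory Defs
  imports "HOL-Complex_Analysis.Complex_Analysis"
begin

definition Gamma2_domain :: "complex set" where
  "Gamma2_domain =
     {\<tau>. Im \<tau> > 0 \<and> \<bar>Re \<tau>\<bar> \<le> 1 \<and> cmod (\<tau> + 1/2) \<ge> 1/2 \<and> cmod (\<tau> - 1/2) \<ge> 1/2}"

definition qpow :: "complex \<Rightarrow> real \<Rightarrow> complex" where
  "qpow \<tau> x = exp (2 * of_real pi * \<i> * of_real x * \<tau>)"

definition jtheta1 :: "complex \<Rightarrow> complex \<Rightarrow> complex" where
  "jtheta1 z \<tau> =
     2 * (\<Sum>n. (-1) ^ n * qpow \<tau> ((real n + 1/2)\<^sup>2 / 2) * sin (of_nat (2*n+1) * of_real pi * z))"

definition jtheta2 :: "complex \<Rightarrow> complex \<Rightarrow> complex" where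
  "jtheta2 z \<tau> =
     2 * (\<Sum>n. qpow \<tau> ((real n + 1/2)\<^sup>2 / 2) * cos (of_nat (2*n+1) * of_real pi * z))"

(* The series of theta_3 and theta_4 start at 1, hence Suc n for the summation index. *)

definition jtheta3 :: "complex \<Rightarrow> complex \<Rightarrow> complex" where
  "jtheta3 z \<tau> =
     1 + 2 * (\<Sum>n. qpow \<tau> ((real (Suc n))\<^sup>2 / 2) * cos (of_nat (2 * Suc n) * of_real pi * z))"

definition jtheta4 :: "complex \<Rightarrow> complex \<Rightarrow> complex" where
  "jtheta4 z \<tau> =
     1 + 2 * (\<Sum>n. (-1) ^ Suc n * qpow \<tau> ((real (Suc n))\<^sup>2 / 2) *
                     cos (of_nat (2 * Suc n) * of_real pi * z))"

definition jacobi_K :: "complex \<Rightarrow> complex" where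
  "jacobi_K \<tau> = of_real pi / 2 * (jtheta3 0 \<tau>)\<^sup>2"

(* The second argument of the elliptic functions is tau rather than the modulus
   k = theta_2(0,tau)^2 / theta_3(0,tau)^2, so jacobi_sn u tau is sn(u, k(tau)); the argument is
   rescaled by u = 2Kz. *)

definition jacobi_sn :: "complex \<Rightarrow> complex \<Rightarrow> complex" where
  "jacobi_sn u \<tau> =
     (let z = u / (2 * jacobi_K \<tau>)
      in jtheta3 0 \<tau> / jtheta2 0 \<tau> * (jtheta1 z \<tau> / jtheta4 z \<tau>))"

definition jacobi_cn :: "complex \<Rightarrow> complex \<Rightarrow> complex" where
  "jacobi_cn u \<tau> =
     (let z = u / (2 * jacobi_K \<tau>)
      in jtheta4 0 \<tau> / jtheta2 0 \<tau> * (jtheta2 z \<tau> / jtheta4 z \<tau>))"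

definition jacobi_dn :: "complex \<Rightarrow> complex \<Rightarrow> complex" where
  "jacobi_dn u \<tau> =
     (let z = u / (2 * jacobi_K \<tau>)
      in jtheta4 0 \<tau> / jtheta3 0 \<tau> * (jtheta3 z \<tau> / jtheta4 z \<tau>))"

(* Quotients of meromorphic functions: sn, cn and dn share their poles (the zeros of theta_4), at
   which cs, ds and ns are nevertheless holomorphic. A pointwise quotient would there be 0 / 0 = 0,
   the wrong value for cs and ds, and such points do occur as arguments (tau/2, for example). *)

definition jacobi_cs :: "complex \<Rightarrow> complex \<Rightarrow> complex" where
  "jacobi_cs u \<tau> = remove_sings (\<lambda>w. jacobi_cn w \<tau> / jacobi_sn w \<tau>) u"

definition jacobi_ds :: "complex \<Rightarrow> complex \<Rightarrow> complex" where
  "jacobi_ds u \<tau> = remove_sings (\<lambda>w. jacobi_dn w \<tau> / jacobi_sn w \<tau>) u"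

definition jacobi_ns :: "complex \<Rightarrow> complex \<Rightarrow> complex" where
  "jacobi_ns u \<tau> = remove_sings (\<lambda>w. 1 / jacobi_sn w \<tau>) u"

(* The indices are read modulo 2: an odd number stands for the class 1, an even one for 0. *)

definition jacobi_f :: "nat \<Rightarrow> nat \<Rightarrow> complex \<Rightarrow> complex \<Rightarrow> complex" where
  "jacobi_f i j z \<tau> =
     (let K = jacobi_K \<tau> in
      if odd i \<and> even j then 2 * K * jacobi_cs (2 * K * z) \<tau>
      else if odd i \<and> odd j then 2 * K * jacobi_ds (2 * K * z) \<tau>
      else if even i \<and> odd j then 2 * K * jacobi_ns (2 * K * z) \<tau>
      else undefined)"

definition jacobi_f_deriv :: "nat \<Rightarrow> nat \<Rightarrow> nat \<Rightarrow> complex \<Rightarrow> complex \<Rightarrow> complex" where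
  "jacobi_f_deriv r i j z \<tau> = (deriv ^^ r) (\<lambda>w. jacobi_f i j w \<tau>) z"

(* f_{i,j}(z,tau) = 1/z * (sum over s of C_{i,j}(s,tau) z^(2s)): C_{i,j}(s,tau) is the Laurent
   coefficient of z^(2s-1) at z = 0. *)

definition jacobi_C :: "nat \<Rightarrow> nat \<Rightarrow> nat \<Rightarrow> complex \<Rightarrow> complex" where
  "jacobi_C i j s \<tau> = fls_nth (laurent_expansion (\<lambda>z. jacobi_f i j z \<tau>) 0) (2 * int s - 1)"

end

theory Submission
  imports Defs
begin

text \<open>
  Put \<open>f = f\<^sub>i\<^sub>,\<^sub>j\<close>, \<open>g = f\<^sub>m\<^sub>,\<^sub>n\<close>, and let \<open>h\<close> be the Jacobi function with
  indices \<open>ia + mb\<close>, \<open>ja + nb\<close>. The function \<open>f(az) g(bz)\<close> has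
  the same multipliers under \<open>z \<mapsto> z + 1\<close> and \<open>z \<mapsto> z + \<tau>\<close> as \<open>h\<close>, simple poles at the nonzero
  \<open>a\<close>- and \<open>b\<close>-division points and a double pole at 0. Subtracting translates of \<open>h\<close> and a multiple
  of \<open>h'\<close> with the same principal parts leaves an entire bounded function with a nontrivial
  multiplier, hence 0. Comparing the coefficients of \<open>z^(2N)\<close> at the origin in the resulting partial
  fraction expansion yields the theorem.

  The analytic input is that each \<open>f\<close> is holomorphic off the period lattice with residue 1 at 0, that
  is, \<open>\<theta>\<^sub>1\<close> vanishes exactly on the lattice and \<open>\<theta>\<^sub>1'(0) = \<pi> \<theta>\<^sub>2 \<theta>\<^sub>3 \<theta>\<^sub>4\<close>. Both facts are clear in the limit of small
  nome and are carried from \<open>2\<tau>\<close> to \<open>\<tau>\<close> by the Landen identities.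
\<close>

section \<open>Theta functions as two-sided series\<close>

text \<open>The parity condition makes one of the two multipliers of h equal to -1, which is what
  excludes a surviving constant in the Liouville argument. Coprimality of a and b keeps the a- and
  b-division points apart modulo the lattice, so f(az) and g(bz) have no common pole off the lattice
  and the values g(bp), f(ap) in the sums are finite. At p = (mu t + nu)/a the residue is (-1)^(i mu
  + j nu) g(bp)/a, the source of the signs and of the factor 1/a. At 0 both f(az) g(bz) and h' are
  even, so no residue enters, and matching 1/(ab z^2) with -1/z^2 yields the term h'/(ab), whose
  coefficient of z^(2N) carries the factor 2N+1. The zeros of theta_1 are located without contour
  integration. For a nome of norm at most 1/12 the first term of the series dominates, with an error
  relative to sin(pi z) and not merely absolute; this pins down the zeros and also gives theta_1'(0)
  asymptotically. For other t the identity theta_1(2z,2t) theta_4(0,2t) = theta_1(z,t) theta_2(z,t)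
  pulls the result back.\<close>

lemma infsum_int_split:
  fixes g :: "int \<Rightarrow> complex"
  assumes "summable (\<lambda>n. norm (g (int n)))" "summable (\<lambda>n. norm (g (- 1 - int n)))"
  shows "(\<lambda>x. norm (g x)) summable_on UNIV"
    and "infsum g UNIV = (\<Sum>n. g (int n) + g (- 1 - int n))"
proof -
  \<comment> \<open>The involution n -> -1 - n exchanges the two halves of the integers; it is also
    the sign change of n + 1/2, which suits the half-integer series.\<close>
  let ?A = "range int" and ?B = "range (\<lambda>n. - 1 - int n)"
  have inj: "inj (\<lambda>n. - 1 - int n)" by (auto intro: injI)
  have UN: "(UNIV :: int set) = ?A \<union> ?B"
  proof -
    have "x \<in> ?A \<union> ?B" for x :: int
    proof (cases "x \<ge> 0")
      case True then show ?thesis by (auto intro: range_eqI[of _ _ "nat x"])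
    next
      case False then show ?thesis by (intro UnI2 range_eqI[of _ _ "nat (- 1 - x)"]) auto
    qed
    then show ?thesis by blast
  qed
  have disj: "?A \<inter> ?B = {}" by auto
  have sA: "(\<lambda>x. norm (g x)) summable_on ?A"
    using assms(1) by (subst summable_on_reindex) (auto simp: o_def summable_on_UNIV_nonneg_real_iff)
  have sB: "(\<lambda>x. norm (g x)) summable_on ?B"
    using assms(2) inj by (subst summable_on_reindex) (auto simp: o_def summable_on_UNIV_nonneg_real_iff)
  show "(\<lambda>x. norm (g x)) summable_on UNIV"
    unfolding UN by (rule summable_on_Un_disjoint[OF sA sB disj])
  have "infsum g UNIV = infsum g ?A + infsum g ?B"
    unfolding UN by (rule infsum_Un_disjoint[OF abs_summable_summable[OF sA] abs_summable_summable[OF sB] disj])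
  also have "infsum g ?A = (\<Sum>n. g (int n))"
    using norm_summable_imp_has_sum[OF assms(1) summable_sums[OF summable_norm_cancel[OF assms(1)]]]
    by (subst infsum_reindex) (auto simp: o_def infsumI)
  also have "infsum g ?B = (\<Sum>n. g (- 1 - int n))"
    using norm_summable_imp_has_sum[OF assms(2) summable_sums[OF summable_norm_cancel[OF assms(2)]]]
    by (subst infsum_reindex[OF inj]) (auto simp: o_def infsumI)
  finally show "infsum g UNIV = (\<Sum>n. g (int n) + g (- 1 - int n))"
    using suminf_add[OF summable_norm_cancel[OF assms(1)] summable_norm_cancel[OF assms(2)]] by simp
qed

text \<open>The n-th root of the n-th term is |c|^n |w|, which tends to 0 for every w; hence the
  terms eventually lie below (1/2)^n.\<close>

lemma summable_norm_power_square:
  fixes c w :: complex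
  assumes "norm c < 1"
  shows "summable (\<lambda>n. norm (c ^ n\<^sup>2 * w ^ n))"
proof -
  have "(\<lambda>n. norm c ^ n * norm w) \<longlonglongrightarrow> 0 * norm w"
    using assms by (intro tendsto_intros LIMSEQ_realpow_zero) auto
  then have "eventually (\<lambda>n. norm c ^ n * norm w < 1 / 2) sequentially"
    by (intro order_tendstoD) auto
  then have "eventually (\<lambda>n. norm (norm (c ^ n\<^sup>2 * w ^ n)) \<le> (1 / 2) ^ n) sequentially"
  proof eventually_elim
    case (elim n)
    have "norm (c ^ n\<^sup>2 * w ^ n) = (norm c ^ n * norm w) ^ n"
      by (simp add: norm_mult norm_power power2_eq_square power_mult power_mult_distrib)
    also have "\<dots> \<le> (1 / 2) ^ n" using elim by (intro power_mono) auto
    finally show ?case by simp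
  qed
  then show ?thesis by (rule summable_comparison_test_ev) (auto intro: summable_geometric)
qed

definition theta_term :: "complex \<Rightarrow> complex \<Rightarrow> int \<Rightarrow> complex" where
  "theta_term z t n = exp (of_real pi * \<i> * ((of_int n)\<^sup>2 * t + 2 * of_int n * z))"

text \<open>This is theta_3. The other Jacobi functions differ from it by shifts of z by 1/2 and t/2
  and an exponential factor, so summations over all integers need to be manipulated for this series
  only.\<close>

definition theta :: "complex \<Rightarrow> complex \<Rightarrow> complex" where
  "theta z t = infsum (theta_term z t) UNIV"

text \<open>The square root of q in the notation q^x: the square of \<open>nome t\<close> is
  \<open>qpow t 1\<close>.\<close>

definition nome :: "complex \<Rightarrow> complex" where
  "nome t = exp (of_real pi * \<i> * t)"

lemma norm_nome: "norm (nome t) = exp (- pi * Im t)"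
  by (simp add: nome_def)

lemma norm_nome_less_1: "Im t > 0 \<Longrightarrow> norm (nome t) < 1"
  by (simp add: norm_nome)

lemma theta_term_of_nat:
  "theta_term z t (int n) = nome t ^ n\<^sup>2 * exp (2 * of_real pi * \<i> * z) ^ n"
  by (simp add: theta_term_def nome_def exp_of_nat_mult [symmetric] exp_add [symmetric] ring_distribs mult_ac)

lemma theta_term_neg:
  "theta_term z t (- 1 - int n) =
     nome t * exp (- (2 * of_real pi * \<i> * z)) *
       (nome t ^ n\<^sup>2 * ((nome t)\<^sup>2 * exp (- (2 * of_real pi * \<i> * z))) ^ n)"
  unfolding theta_term_def nome_def
  by (simp only: exp_of_nat_mult [symmetric] exp_add [symmetric] power_mult_distrib power_mult [symmetric])
     (rule arg_cong[where f = exp], simp add: algebra_simps power2_eq_square)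

lemma
  assumes "Im t > 0"
  shows theta_term_abs_summable: "(\<lambda>n. norm (theta_term z t n)) summable_on UNIV"
    and theta_conv_suminf: "theta z t = (\<Sum>n. theta_term z t (int n) + theta_term z t (- 1 - int n))"
    and summable_theta_term1: "summable (\<lambda>n. norm (theta_term z t (int n)))"
    and summable_theta_term2: "summable (\<lambda>n. norm (theta_term z t (- 1 - int n)))"
proof -
  note q = norm_nome_less_1[OF assms]
  show 1: "summable (\<lambda>n. norm (theta_term z t (int n)))"
    unfolding theta_term_of_nat by (rule summable_norm_power_square[OF q])
  show 2: "summable (\<lambda>n. norm (theta_term z t (- 1 - int n)))"
    unfolding theta_term_neg
    by (subst norm_mult) (intro summable_mult summable_norm_power_square[OF q])
  show "(\<lambda>n. norm (theta_term z t n)) summable_on UNIV"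
    by (rule infsum_int_split(1)[OF 1 2])
  show "theta z t = (\<Sum>n. theta_term z t (int n) + theta_term z t (- 1 - int n))"
    unfolding theta_def by (rule infsum_int_split(2)[OF 1 2])
qed

text \<open>As a series in e^(2 pi i z) theta is two-sided. Split at 0, both halves are values of
  one entire power series P, at e^(2 pi i z) and at a multiple of its inverse.\<close>

lemma theta_holomorphic:
  assumes "Im t > 0"
  shows "(\<lambda>z. theta z t) holomorphic_on A"
proof -
  define P where "P = (\<lambda>w. \<Sum>n. nome t ^ n\<^sup>2 * w ^ n)"
  have P: "(\<lambda>n. nome t ^ n\<^sup>2 * w ^ n) sums P w" for w
    unfolding P_def
    by (intro summable_sums summable_norm_cancel[OF summable_norm_power_square] norm_nome_less_1 assms)
  have hol_ball: "P holomorphic_on ball 0 r" for r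
    by (rule power_series_holomorphic[where a = "\<lambda>n. nome t ^ n\<^sup>2"]) (use P in auto)
  have "P field_differentiable at w" for w
    using holomorphic_on_imp_differentiable_at[OF hol_ball[of "norm w + 1"], of w] by auto
  then have hol: "P holomorphic_on UNIV"
    by (auto simp: holomorphic_on_def field_differentiable_at_within)
  define E where "E = (\<lambda>z. exp (2 * of_real pi * \<i> * z))"
  have "theta z t = P (E z) + nome t * exp (- (2 * of_real pi * \<i> * z)) * P ((nome t)\<^sup>2 * exp (- (2 * of_real pi * \<i> * z)))" for z
  proof -
    have "(\<lambda>n. theta_term z t (int n)) sums P (E z)"
      unfolding theta_term_of_nat E_def by (rule P)
    moreover have "(\<lambda>n. theta_term z t (- 1 - int n)) sums (nome t * exp (- (2 * of_real pi * \<i> * z)) *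
        P ((nome t)\<^sup>2 * exp (- (2 * of_real pi * \<i> * z))))"
      unfolding theta_term_neg by (rule sums_mult[OF P])
    ultimately show ?thesis
      unfolding theta_conv_suminf[OF assms] by (intro sums_unique[symmetric] sums_add)
  qed
  moreover have "(\<lambda>z. P (E z) + nome t * exp (- (2 * of_real pi * \<i> * z)) * P ((nome t)\<^sup>2 * exp (- (2 * of_real pi * \<i> * z)))) holomorphic_on A"
    unfolding E_def
    by (intro holomorphic_intros holomorphic_on_compose_gen[OF _ hol, unfolded o_def]) auto
  ultimately show ?thesis by simp
qed

lemma theta_plus_1: "theta (z + 1) t = theta z t"
  unfolding theta_def
proof (rule infsum_cong)
  fix n
  have "theta_term (z + 1) t n = theta_term z t n * exp (2 * of_int n * of_real pi * \<i>)"
    unfolding theta_term_def exp_add [symmetric]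
    by (rule arg_cong[where f = exp]) (simp add: algebra_simps)
  then show "theta_term (z + 1) t n = theta_term z t n"
    using exp_integer_2pi[of "of_int n"] by simp
qed

text \<open>Completing the square: n^2 t + 2n(z + t) = (n+1)^2 t + 2(n+1)z - (t + 2z), followed by
  the index shift n -> n + 1.\<close>

lemma theta_plus_tau: "theta (z + t) t = exp (- (of_real pi * \<i> * (t + 2 * z))) * theta z t"
proof -
  have "theta (z + t) t = infsum (\<lambda>n. exp (- (of_real pi * \<i> * (t + 2 * z))) * theta_term z t (n + 1)) UNIV"
    unfolding theta_def
  proof (rule infsum_cong)
    show "theta_term (z + t) t n = exp (- (of_real pi * \<i> * (t + 2 * z))) * theta_term z t (n + 1)" for n
      unfolding theta_term_def exp_add [symmetric]
      by (rule arg_cong[where f = exp]) (simp add: algebra_simps power2_eq_square)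
  qed
  also have "\<dots> = exp (- (of_real pi * \<i> * (t + 2 * z))) * infsum (\<lambda>n. theta_term z t (n + 1)) UNIV"
    by (rule infsum_cmult_right')
  also have "infsum (\<lambda>n. theta_term z t (n + 1)) UNIV = theta z t" unfolding theta_def
    by (rule infsum_reindex_bij_witness[of _ "\<lambda>n. n - 1" "\<lambda>n. n + 1"]) auto
  finally show ?thesis .
qed

section \<open>Products of theta functions\<close>

lemma infsum_mult_Times:
  fixes f :: "'a \<Rightarrow> complex" and g :: "'b \<Rightarrow> complex"
  assumes f: "(\<lambda>x. norm (f x)) summable_on A" and g: "(\<lambda>y. norm (g y)) summable_on B"
  shows "(\<lambda>(x, y). f x * g y) summable_on A \<times> B"
    and "infsum (\<lambda>(x, y). f x * g y) (A \<times> B) = infsum f A * infsum g B"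
proof -
  have "(\<lambda>p. norm (case p of (x, y) \<Rightarrow> f x * g y)) summable_on A \<times> B"
    unfolding Infinite_Sum.abs_summable_on_Sigma_iff
  proof (intro conjI ballI)
    show "(\<lambda>y. norm (case (x, y) of (x, y) \<Rightarrow> f x * g y)) summable_on B" for x
      using summable_on_cmult_right[OF g, of "norm (f x)"] by (simp add: norm_mult)
    show "(\<lambda>x. norm (\<Sum>\<^sub>\<infinity>y\<in>B. norm (case (x, y) of (x, y) \<Rightarrow> f x * g y))) summable_on A"
      using summable_on_cmult_left[OF f, of "\<Sum>\<^sub>\<infinity>y\<in>B. norm (g y)"]
      by (simp add: norm_mult infsum_cmult_right' abs_mult infsum_nonneg)
  qed
  then show s: "(\<lambda>(x, y). f x * g y) summable_on A \<times> B"
    by (rule abs_summable_summable)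
  show "infsum (\<lambda>(x, y). f x * g y) (A \<times> B) = infsum f A * infsum g B"
    using infsum_Sigma'_banach[OF s] by (simp add: infsum_cmult_right' infsum_cmult_left')
qed

text \<open>The substitution \<open>(m, n) = (k + l, k - l)\<close> or \<open>(k + l + 1, k - l)\<close>, according to the parity
  of \<open>m + n\<close>, diagonalises \<open>m\<^sup>2 + n\<^sup>2\<close>.\<close>

lemma theta_mult_theta:
  assumes "Im t > 0"
  shows "theta z t * theta w t = theta (z + w) (2 * t) * theta (z - w) (2 * t) +
           exp (of_real pi * \<i> * (t + 2 * z)) * (theta (z + w + t) (2 * t) * theta (z - w + t) (2 * t))"
proof -
  let ?T = theta_term
  define F where "F = (\<lambda>(m, n). ?T z t m * ?T w t n)"
  define E where "E = {p :: int \<times> int. even (fst p + snd p)}"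
  have t2: "Im (2 * t) > 0" using assms by simp
  note sum1 = infsum_mult_Times[OF theta_term_abs_summable[OF assms] theta_term_abs_summable[OF assms]]
  note sum2 = infsum_mult_Times[OF theta_term_abs_summable[OF t2] theta_term_abs_summable[OF t2]]
  have sF: "F summable_on UNIV" "theta z t * theta w t = infsum F UNIV"
    using sum1[of z w] by (simp_all add: F_def theta_def)
  have "infsum F UNIV = infsum F E + infsum F (- E)"
    using infsum_Un_disjoint[OF summable_on_subset_banach[OF sF(1), of E]
        summable_on_subset_banach[OF sF(1), of "- E"]] by (simp add: Compl_partition)
  also have "infsum F E = infsum (\<lambda>(k, l). ?T (z + w) (2 * t) k * ?T (z - w) (2 * t) l) (UNIV \<times> UNIV)"
  proof (rule infsum_reindex_bij_witness[of _ "\<lambda>(k, l). (k + l, k - l)" "\<lambda>(m, n). ((m + n) div 2, (m - n) div 2)"])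
    fix p assume "p \<in> E"
    then obtain m n where p: "p = (m, n)" "even (m + n)" by (cases p) (auto simp: E_def)
    define k l where "k = (m + n) div 2" and "l = (m - n) div 2"
    have "m + n = 2 * k" "m - n = 2 * l" using p(2) by (auto simp: k_def l_def)
    then have mn: "k + l = m" "k - l = n" by auto
    have d: "(m + n) div 2 = k" "(m - n) div 2 = l" by (simp_all add: k_def l_def)
    have "F (k + l, k - l) = ?T (z + w) (2 * t) k * ?T (z - w) (2 * t) l"
      unfolding F_def theta_term_def exp_add [symmetric] prod.case
      by (rule arg_cong[where f = exp]) (simp add: algebra_simps power2_eq_square)
    then show "(case case p of (m, n) \<Rightarrow> ((m + n) div 2, (m - n) div 2) of
          (k, l) \<Rightarrow> ?T (z + w) (2 * t) k * ?T (z - w) (2 * t) l) = F p"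
      by (simp only: p(1) d mn prod.case)
    show "(case case p of (m, n) \<Rightarrow> ((m + n) div 2, (m - n) div 2) of (k, l) \<Rightarrow> (k + l, k - l)) = p"
      by (simp only: p(1) d mn prod.case)
  qed (auto simp: E_def)
  also have "\<dots> = theta (z + w) (2 * t) * theta (z - w) (2 * t)"
    using sum2 by (simp add: theta_def)
  also have "infsum F (- E) = infsum (\<lambda>p. exp (of_real pi * \<i> * (t + 2 * z)) *
       (case p of (k, l) \<Rightarrow> ?T (z + w + t) (2 * t) k * ?T (z - w + t) (2 * t) l)) (UNIV \<times> UNIV)"
  proof (rule infsum_reindex_bij_witness[of _ "\<lambda>(k, l). (k + l + 1, k - l)"
        "\<lambda>(m, n). ((m + n) div 2, (m - n) div 2)"])
    fix p assume "p \<in> - E"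
    then obtain m n where p: "p = (m, n)" "odd (m + n)" by (cases p) (auto simp: E_def)
    define k l where "k = (m + n) div 2" and "l = (m - n) div 2"
    have "m + n = 2 * k + 1" "m - n = 2 * l + 1" using p(2) by (auto simp: k_def l_def)
    then have mn: "k + l + 1 = m" "k - l = n" by auto
    have d: "(m + n) div 2 = k" "(m - n) div 2 = l" by (simp_all add: k_def l_def)
    have "F (k + l + 1, k - l) = exp (of_real pi * \<i> * (t + 2 * z)) *
        (?T (z + w + t) (2 * t) k * ?T (z - w + t) (2 * t) l)"
      unfolding F_def theta_term_def exp_add [symmetric] prod.case
      by (rule arg_cong[where f = exp]) (simp add: algebra_simps power2_eq_square)
    then show "exp (of_real pi * \<i> * (t + 2 * z)) * (case case p of (m, n) \<Rightarrow> ((m + n) div 2, (m - n) div 2) of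
          (k, l) \<Rightarrow> ?T (z + w + t) (2 * t) k * ?T (z - w + t) (2 * t) l) = F p"
      by (simp only: p(1) d mn prod.case)
    show "(case case p of (m, n) \<Rightarrow> ((m + n) div 2, (m - n) div 2) of (k, l) \<Rightarrow> (k + l + 1, k - l)) = p"
      by (simp only: p(1) d mn prod.case)
  qed (auto simp: E_def)
  also have "\<dots> = exp (of_real pi * \<i> * (t + 2 * z)) * (theta (z + w + t) (2 * t) * theta (z - w + t) (2 * t))"
    using sum2 by (simp add: theta_def infsum_cmult_right')
  finally show ?thesis using sF(2) by simp
qed

section \<open>The four Jacobi series as shifts of \<open>theta\<close>\<close>

lemma cos_conv_exp: "2 * cos (z :: complex) = exp (\<i> * z) + exp (- (\<i> * z))"
  by (simp add: cos_exp_eq)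

lemma
  assumes "Im t > 0"
  shows jtheta3_summable: "summable (\<lambda>n. qpow t ((real (Suc n))\<^sup>2 / 2) * cos (of_nat (2 * Suc n) * of_real pi * z))"
    and jtheta3_conv_theta: "jtheta3 z t = theta z t"
proof -
  let ?f = "\<lambda>n. qpow t ((real (Suc n))\<^sup>2 / 2) * cos (of_nat (2 * Suc n) * of_real pi * z)"
  note s1 = summable_norm_cancel[OF summable_theta_term1[OF assms, of z]]
  note s2 = summable_norm_cancel[OF summable_theta_term2[OF assms, of z]]
  note s1' = s1[THEN summable_ignore_initial_segment, of 1]
  \<comment> \<open>Here -1 - n is paired with its negative n + 1; the index 0 that is left over
    supplies the leading 1.\<close>
  have eq: "theta_term z t (int (Suc n)) + theta_term z t (- 1 - int n) = 2 * ?f n" for n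
  proof -
    have "2 * ?f n = qpow t ((real (Suc n))\<^sup>2 / 2) * (2 * cos (of_nat (2 * Suc n) * of_real pi * z))"
      by simp
    also have "\<dots> = theta_term z t (int (Suc n)) + theta_term z t (- 1 - int n)"
      unfolding cos_conv_exp ring_distribs qpow_def theta_term_def exp_add [symmetric]
      by (intro arg_cong2[where f = "(+)"] arg_cong[where f = exp]) (simp_all add: algebra_simps power2_eq_square)
    finally show ?thesis by simp
  qed
  have "summable (\<lambda>n. theta_term z t (int (Suc n)) + theta_term z t (- 1 - int n))"
    using s1' s2 by (intro summable_add) auto
  then have "summable (\<lambda>n. 2 * ?f n)" unfolding eq .
  then show s: "summable ?f" by (subst (asm) summable_cmult_iff) auto
  have "theta z t = (\<Sum>n. theta_term z t (int n)) + (\<Sum>n. theta_term z t (- 1 - int n))"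
    unfolding theta_conv_suminf[OF assms] by (rule suminf_add[OF s1 s2, symmetric])
  also have "(\<Sum>n. theta_term z t (int n)) = 1 + (\<Sum>n. theta_term z t (int (Suc n)))"
    using suminf_split_head[OF s1] by (simp add: theta_term_def)
  also have "1 + (\<Sum>n. theta_term z t (int (Suc n))) + (\<Sum>n. theta_term z t (- 1 - int n)) =
      1 + (\<Sum>n. 2 * ?f n)"
    unfolding eq [symmetric] using suminf_add[OF s1' s2] by simp
  finally show "jtheta3 z t = theta z t"
    unfolding jtheta3_def suminf_mult[OF s] by simp
qed

text \<open>(n + 1/2)^2 t + 2(n + 1/2)z = n^2 t + 2n(z + t/2) + (t/4 + z), and the indices n and -1
  - n give the two exponentials of the cosine.\<close>

lemma
  assumes "Im t > 0"
  shows jtheta2_summable: "summable (\<lambda>n. qpow t ((real n + 1/2)\<^sup>2 / 2) * cos (of_nat (2*n+1) * of_real pi * z))"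
    and jtheta2_conv_theta: "jtheta2 z t = exp (of_real pi * \<i> * (t / 4 + z)) * theta (z + t / 2) t"
proof -
  let ?f = "\<lambda>n. qpow t ((real n + 1/2)\<^sup>2 / 2) * cos (of_nat (2*n+1) * of_real pi * z)"
  let ?E = "exp (of_real pi * \<i> * (t / 4 + z))"
  have s: "summable (\<lambda>n. theta_term (z + t / 2) t (int n) + theta_term (z + t / 2) t (- 1 - int n))"
    using summable_norm_cancel[OF summable_theta_term1[OF assms]]
      summable_norm_cancel[OF summable_theta_term2[OF assms]] by (rule summable_add)
  have eq: "?E * (theta_term (z + t / 2) t (int n) + theta_term (z + t / 2) t (- 1 - int n)) = 2 * ?f n" for n
  proof -
    have "2 * ?f n = qpow t ((real n + 1/2)\<^sup>2 / 2) * (2 * cos (of_nat (2*n+1) * of_real pi * z))"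
      by simp
    also have "\<dots> = ?E * (theta_term (z + t / 2) t (int n) + theta_term (z + t / 2) t (- 1 - int n))"
      unfolding cos_conv_exp ring_distribs qpow_def theta_term_def exp_add [symmetric]
      by (rule arg_cong2[where f = "(+)"]; rule arg_cong[where f = exp])
         (simp_all add: field_simps power2_eq_square)
    finally show ?thesis by simp
  qed
  from summable_mult[OF s, of ?E] have "summable (\<lambda>n. 2 * ?f n)" unfolding eq .
  then show s': "summable ?f" by (subst (asm) summable_cmult_iff) auto
  have "?E * theta (z + t / 2) t = (\<Sum>n. 2 * ?f n)"
    unfolding theta_conv_suminf[OF assms] suminf_mult[OF s, symmetric] eq ..
  then show "jtheta2 z t = ?E * theta (z + t / 2) t"
    unfolding jtheta2_def suminf_mult[OF s'] by simp
qed

lemma cos_plus_nat_pi: "cos (z + of_nat n * of_real pi) = (-1) ^ n * cos (z :: complex)"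
proof (induction n)
  case (Suc n)
  have "z + of_nat (Suc n) * of_real pi = (z + of_nat n * of_real pi) + of_real pi"
    by (simp add: algebra_simps)
  then show ?case by (simp only: cos_add Suc) (simp add: Suc)
qed simp

lemma jtheta4_eq_jtheta3: "jtheta4 z t = jtheta3 (z + 1 / 2) t"
proof -
  have "cos (of_nat (2 * Suc n) * of_real pi * (z + 1 / 2)) =
      (-1) ^ Suc n * cos (of_nat (2 * Suc n) * of_real pi * z)" for n
    unfolding cos_plus_nat_pi [symmetric] by (rule arg_cong[where f = cos]) (simp add: field_simps)
  then show ?thesis unfolding jtheta4_def jtheta3_def by (simp add: mult_ac)
qed

lemma jtheta2_eq_jtheta1: "jtheta2 z t = jtheta1 (z + 1 / 2) t"
proof -
  have "sin (of_nat (2*n+1) * of_real pi * (z + 1 / 2)) =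
      (-1) ^ n * cos (of_nat (2*n+1) * of_real pi * z)" for n
  proof -
    have "of_nat (2*n+1) * of_real pi * (z + 1 / 2) =
        of_nat (2*n+1) * of_real pi * z + of_nat n * of_real pi + of_real pi / 2"
      by (simp add: field_simps)
    then show ?thesis by (simp only: cos_plus_nat_pi [symmetric] sin_add) simp
  qed
  note sin_eq = this
  have "(-1) ^ n * qpow t ((real n + 1/2)\<^sup>2 / 2) * sin (of_nat (2*n+1) * of_real pi * (z + 1 / 2)) =
     qpow t ((real n + 1/2)\<^sup>2 / 2) * cos (of_nat (2*n+1) * of_real pi * z)" for n
  proof -
    have "(-1) ^ n * (-1) ^ n = (1 :: complex)" by (simp flip: power_mult_distrib)
    then show ?thesis unfolding sin_eq by (simp add: mult_ac)
  qed
  then show ?thesis unfolding jtheta1_def jtheta2_def by (simp only:)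
qed

section \<open>Quasi-periodicity and Landen identities\<close>

lemma sin_odd_multiple_shift:
  "cos (of_nat (2*n+1) * of_real pi * (z - 1 / 2)) = (-1) ^ n * sin (of_nat (2*n+1) * of_real pi * (z :: complex))"
proof -
  have "of_nat (2*n+1) * of_real pi * (z - 1 / 2) + of_nat n * of_real pi =
      of_nat (2*n+1) * of_real pi * z - of_real pi / 2"
    by (simp add: field_simps)
  then have "(-1) ^ n * cos (of_nat (2*n+1) * of_real pi * (z - 1 / 2)) = sin (of_nat (2*n+1) * of_real pi * z)"
    by (simp only: cos_plus_nat_pi [symmetric] cos_diff) simp
  moreover have "(-1) ^ n * (-1) ^ n = (1 :: complex)" by (simp flip: power_mult_distrib)
  ultimately show ?thesis by (metis mult.assoc mult_1)
qed

lemma jtheta1_summable: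
  assumes "Im t > 0"
  shows "summable (\<lambda>n. (-1) ^ n * qpow t ((real n + 1/2)\<^sup>2 / 2) * sin (of_nat (2*n+1) * of_real pi * z))"
  using jtheta2_summable[OF assms, of "z - 1 / 2"] unfolding sin_odd_multiple_shift
  by (simp add: mult_ac)

lemma jtheta1_eq_jtheta2: "jtheta1 z t = jtheta2 (z - 1 / 2) t"
  by (simp add: jtheta2_eq_jtheta1)

lemma jtheta2_plus_1:
  assumes "Im t > 0" shows "jtheta2 (z + 1) t = - jtheta2 z t"
proof -
  have "theta (z + 1 + t / 2) t = theta (z + t / 2) t"
    using theta_plus_1[of "z + t / 2" t] by (simp add: add_ac)
  moreover have "exp (of_real pi * \<i> * (t / 4 + (z + 1))) = - exp (of_real pi * \<i> * (t / 4 + z))"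
    by (simp add: ring_distribs exp_add)
  ultimately show ?thesis by (simp add: jtheta2_conv_theta[OF assms])
qed

lemma jtheta2_minus: "jtheta2 (- z) t = jtheta2 z t"
  by (simp add: jtheta2_def)

lemma jtheta1_plus_1: "Im t > 0 \<Longrightarrow> jtheta1 (z + 1) t = - jtheta1 z t"
  using jtheta2_plus_1[of t "z - 1 / 2"] by (simp add: jtheta1_eq_jtheta2 algebra_simps)

lemma jtheta1_minus: "Im t > 0 \<Longrightarrow> jtheta1 (- z) t = - jtheta1 z t"
  using jtheta1_plus_1[of t "z - 1 / 2"] jtheta2_minus[of z t] jtheta2_minus[of "z - 1 / 2" t]
  using jtheta2_eq_jtheta1[of "z - 1 / 2" t] jtheta2_eq_jtheta1[of "- (z - 1 / 2)" t]
  using jtheta1_plus_1[of t "- z"]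
  by (simp add: algebra_simps)

lemma jtheta3_plus_1: "Im t > 0 \<Longrightarrow> jtheta3 (z + 1) t = jtheta3 z t"
  by (simp add: jtheta3_conv_theta theta_plus_1)

lemma jtheta3_minus: "jtheta3 (- z) t = jtheta3 z t"
  by (simp add: jtheta3_def)

lemma jtheta4_plus_1: "Im t > 0 \<Longrightarrow> jtheta4 (z + 1) t = jtheta4 z t"
  using jtheta3_plus_1[of t "z + 1 / 2"] by (simp add: jtheta4_eq_jtheta3 add_ac)

lemma jtheta4_minus: "jtheta4 (- z) t = jtheta4 z t"
  by (simp add: jtheta4_def)

lemma jtheta3_plus_tau:
  "Im t > 0 \<Longrightarrow> jtheta3 (z + t) t = exp (- (of_real pi * \<i> * (t + 2 * z))) * jtheta3 z t"
  by (simp add: jtheta3_conv_theta theta_plus_tau)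

lemma jtheta4_plus_tau:
  assumes "Im t > 0"
  shows "jtheta4 (z + t) t = - exp (- (of_real pi * \<i> * (t + 2 * z))) * jtheta4 z t"
proof -
  have "exp (- (of_real pi * \<i> * (t + 2 * (z + 1 / 2)))) = - exp (- (of_real pi * \<i> * (t + 2 * z)))"
  proof -
    have "- (of_real pi * \<i> * (t + 2 * (z + 1 / 2))) = - (of_real pi * \<i> * (t + 2 * z)) - of_real pi * \<i>"
      by (simp add: ring_distribs)
    then show ?thesis by (simp only: exp_diff) simp
  qed
  then show ?thesis
    using jtheta3_plus_tau[OF assms, of "z + 1 / 2"] by (simp add: jtheta4_eq_jtheta3 add_ac)
qed

lemma jtheta2_plus_tau:
  assumes "Im t > 0"
  shows "jtheta2 (z + t) t = exp (- (of_real pi * \<i> * (t + 2 * z))) * jtheta2 z t"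
proof -
  have "theta (z + t + t / 2) t = exp (- (of_real pi * \<i> * (t + 2 * (z + t / 2)))) * theta (z + t / 2) t"
    using theta_plus_tau[of "z + t / 2" t] by (simp add: add_ac)
  moreover have "exp (of_real pi * \<i> * (t / 4 + (z + t))) * exp (- (of_real pi * \<i> * (t + 2 * (z + t / 2)))) =
      exp (- (of_real pi * \<i> * (t + 2 * z))) * exp (of_real pi * \<i> * (t / 4 + z))"
    unfolding exp_add [symmetric] by (rule arg_cong[where f = exp]) (simp add: field_simps)
  ultimately show ?thesis by (simp add: jtheta2_conv_theta[OF assms] mult.assoc [symmetric])
qed

lemma jtheta1_plus_tau:
  assumes "Im t > 0"
  shows "jtheta1 (z + t) t = - exp (- (of_real pi * \<i> * (t + 2 * z))) * jtheta1 z t"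
proof -
  have "exp (- (of_real pi * \<i> * (t + 2 * (z - 1 / 2)))) = - exp (- (of_real pi * \<i> * (t + 2 * z)))"
  proof -
    have "- (of_real pi * \<i> * (t + 2 * (z - 1 / 2))) = - (of_real pi * \<i> * (t + 2 * z)) + of_real pi * \<i>"
      by (simp add: ring_distribs)
    then show ?thesis by (simp only: exp_add) simp
  qed
  then show ?thesis
    using jtheta2_plus_tau[OF assms, of "z - 1 / 2"] by (simp add: jtheta1_eq_jtheta2 algebra_simps)
qed

lemma jtheta_holomorphic:
  assumes "Im t > 0"
  shows "(\<lambda>z. jtheta1 z t) holomorphic_on A" "(\<lambda>z. jtheta2 z t) holomorphic_on A"
    "(\<lambda>z. jtheta3 z t) holomorphic_on A" "(\<lambda>z. jtheta4 z t) holomorphic_on A"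
proof -
  have th: "(\<lambda>z. theta (z + c) t) holomorphic_on A" for c A
    using holomorphic_on_compose[OF _ theta_holomorphic[OF assms], of "\<lambda>z. z + c" A]
    by (simp add: o_def holomorphic_intros)
  show "(\<lambda>z. jtheta3 z t) holomorphic_on A" using th[of 0] by (simp add: jtheta3_conv_theta[OF assms])
  show "(\<lambda>z. jtheta4 z t) holomorphic_on A"
    using th[of "1 / 2"] by (simp add: jtheta4_eq_jtheta3 jtheta3_conv_theta[OF assms])
  have j2: "(\<lambda>z. jtheta2 z t) holomorphic_on A" for A
    unfolding jtheta2_conv_theta[OF assms] by (intro holomorphic_intros th)
  then show "(\<lambda>z. jtheta2 z t) holomorphic_on A" .
  show "(\<lambda>z. jtheta1 z t) holomorphic_on A" unfolding jtheta1_eq_jtheta2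
    using holomorphic_on_compose[OF _ j2, of "\<lambda>z. z - 1 / 2" A]
    by (simp add: o_def holomorphic_intros)
qed

text \<open>\<open>theta_mult_theta\<close> with both arguments moved by t/2. In the first summand
  \<open>z + w\<close> moves by t, a half period for \<open>2 * t\<close>, which produces theta_2.
  In the second it moves by the full period \<open>2 * t\<close>, which
  \<open>theta_plus_tau\<close> removes, while \<open>z - w\<close> has moved by t.\<close>

lemma jtheta2_mult_jtheta2:
  assumes "Im t > 0"
  shows "jtheta2 z t * jtheta2 w t = jtheta2 (z + w) (2 * t) * jtheta3 (z - w) (2 * t) +
           jtheta3 (z + w) (2 * t) * jtheta2 (z - w) (2 * t)"
proof -
  have t2: "Im (2 * t) > 0" using assms by simp
  let ?e = "\<lambda>x. exp (of_real pi * \<i> * x)"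
  have 1: "theta (z + t / 2) t * theta (w + t / 2) t =
      theta (z + w + t) (2 * t) * theta (z - w) (2 * t) +
      ?e (2 * t + 2 * z) * (theta (z + w + 2 * t) (2 * t) * theta (z - w + t) (2 * t))"
    using theta_mult_theta[OF assms, of "z + t / 2" "w + t / 2"] by (simp add: algebra_simps)
  have 2: "theta (z + w + 2 * t) (2 * t) = ?e (- (2 * t + 2 * (z + w))) * theta (z + w) (2 * t)"
    using theta_plus_tau[of "z + w" "2 * t"] by (simp only: mult_minus_right)
  have 3: "?e (t / 4 + z) * ?e (t / 4 + w) = ?e (2 * t / 4 + (z + w))"
    unfolding exp_add [symmetric] by (rule arg_cong[where f = exp]) (simp add: field_simps)
  have 4: "?e (2 * t / 4 + (z + w)) * (?e (2 * t + 2 * z) * ?e (- (2 * t + 2 * (z + w)))) = ?e (2 * t / 4 + (z - w))"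
    unfolding exp_add [symmetric] by (rule arg_cong[where f = exp]) (simp add: field_simps)
  have "jtheta2 z t * jtheta2 w t = (?e (t / 4 + z) * ?e (t / 4 + w)) * (theta (z + t / 2) t * theta (w + t / 2) t)"
    by (simp add: jtheta2_conv_theta[OF assms] mult_ac)
  also have "\<dots> = ?e (2 * t / 4 + (z + w)) * theta (z + w + t) (2 * t) * theta (z - w) (2 * t) +
      (?e (2 * t / 4 + (z + w)) * (?e (2 * t + 2 * z) * ?e (- (2 * t + 2 * (z + w))))) *
        (theta (z + w) (2 * t) * theta (z - w + t) (2 * t))"
    unfolding 1 2 3 by (simp only: ring_distribs mult_ac)
  also have "\<dots> = jtheta2 (z + w) (2 * t) * jtheta3 (z - w) (2 * t) +
           jtheta3 (z + w) (2 * t) * jtheta2 (z - w) (2 * t)"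
    unfolding 4 jtheta2_conv_theta[OF t2] jtheta3_conv_theta[OF t2] by simp
  finally show ?thesis .
qed

lemma jtheta2_half: "Im t > 0 \<Longrightarrow> jtheta2 (1 / 2) t = 0"
  using jtheta2_plus_1[of t "- 1 / 2"] jtheta2_minus[of "1 / 2" t] by simp

text \<open>The arguments \<open>z - 1 / 2\<close> and \<open>z\<close> differ by 1/2, where theta_2
  vanishes, so one of the two products disappears.\<close>

lemma landen_jtheta1:
  assumes "Im t > 0"
  shows "jtheta1 (2 * z) (2 * t) * jtheta4 0 (2 * t) = jtheta1 z t * jtheta2 z t"
proof -
  have t2: "Im (2 * t) > 0" using assms by simp
  have "jtheta1 z t * jtheta2 z t = jtheta2 (2 * z - 1 / 2) (2 * t) * jtheta3 (- (1 / 2)) (2 * t)"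
    using jtheta2_mult_jtheta2[OF assms, of "z - 1 / 2" z] jtheta2_half[OF t2]
      jtheta2_minus[of "1 / 2" "2 * t"]
    by (simp add: jtheta1_eq_jtheta2)
  then show ?thesis
    using jtheta3_minus[of "1 / 2" "2 * t"] by (simp add: jtheta1_eq_jtheta2 jtheta4_eq_jtheta3)
qed

lemma landen_jtheta2:
  assumes "Im t > 0"
  shows "2 * jtheta2 0 (2 * t) * jtheta3 0 (2 * t) = (jtheta2 0 t)\<^sup>2"
  using jtheta2_mult_jtheta2[OF assms, of 0 0] by (simp add: power2_eq_square)

text \<open>In \<open>theta_mult_theta\<close> at 1/2 and 0 the second product contains theta(1/2 +
  t, 2t), which is theta_2(1/2, 2t) up to an exponential, hence 0.\<close>

lemma landen_jtheta4:
  assumes "Im t > 0"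
  shows "(jtheta4 0 (2 * t))\<^sup>2 = jtheta3 0 t * jtheta4 0 t"
proof -
  have t2: "Im (2 * t) > 0" using assms by simp
  have "theta (1 / 2 + t) (2 * t) = 0"
    using jtheta2_half[OF t2] jtheta2_conv_theta[OF t2, of "1 / 2"] by simp
  then have "theta (1 / 2) t * theta 0 t = theta (1 / 2) (2 * t) * theta (1 / 2) (2 * t)"
    using theta_mult_theta[OF assms, of "1 / 2" 0] by simp
  then show ?thesis
    using assms t2 by (simp add: jtheta4_eq_jtheta3 jtheta3_conv_theta power2_eq_square mult.commute)
qed

section \<open>Behaviour for small nome and descent under doubling\<close>

lemma norm_cos_le_exp: "norm (cos z) \<le> exp \<bar>Im z\<bar>" for z :: complex
proof -
  have "norm (2 * cos z) \<le> exp (- Im z) + exp (Im z)"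
    unfolding cos_conv_exp using norm_triangle_ineq[of "exp (\<i> * z)" "exp (- (\<i> * z))"] by simp
  also have "\<dots> \<le> exp \<bar>Im z\<bar> + exp \<bar>Im z\<bar>" by (intro add_mono) auto
  finally show ?thesis by (simp add: norm_mult)
qed

text \<open>The factor \<open>norm (sin w)\<close> is the point: it keeps the later terms of theta_1
  small relative to the first one even near the zeros of the sine. It comes from sin(v + w) - sin(v
  - w) = 2 cos v sin w with v = (2n+2)w.\<close>

lemma norm_sin_odd_multiple_le:
  fixes w :: complex
  shows "norm (sin (of_nat (2*n+1) * w)) \<le> real (2*n+1) * norm (sin w) * exp (real (2*n) * \<bar>Im w\<bar>)"
proof (induction n)
  case (Suc n)
  let ?v = "of_nat (2*n+2) * w"
  have split: "of_nat (2*Suc n+1) * w = ?v + w" "of_nat (2*n+1) * w = ?v - w"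
    by (simp_all add: algebra_simps)
  have "sin (of_nat (2*Suc n+1) * w) = sin (of_nat (2*n+1) * w) + 2 * (cos ?v * sin w)"
    unfolding split by (simp add: sin_add sin_diff)
  then have "norm (sin (of_nat (2*Suc n+1) * w)) \<le> norm (sin (of_nat (2*n+1) * w)) + 2 * (norm (cos ?v) * norm (sin w))"
    using norm_triangle_ineq[of "sin (of_nat (2*n+1) * w)" "2 * (cos ?v * sin w)"] by (simp add: norm_mult)
  also have "\<dots> \<le> real (2*n+1) * norm (sin w) * exp (real (2 * Suc n) * \<bar>Im w\<bar>) +
      2 * (exp (real (2 * Suc n) * \<bar>Im w\<bar>) * norm (sin w))"
  proof (intro add_mono mult_left_mono mult_right_mono)
    have "\<bar>Im ?v\<bar> = real (2 * Suc n) * \<bar>Im w\<bar>" by (simp add: abs_mult)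
    then show "norm (cos ?v) \<le> exp (real (2 * Suc n) * \<bar>Im w\<bar>)" using norm_cos_le_exp[of ?v] by simp
    show "norm (sin (of_nat (2*n+1) * w)) \<le> real (2*n+1) * norm (sin w) * exp (real (2 * Suc n) * \<bar>Im w\<bar>)"
      by (rule order_trans[OF Suc]) (intro mult_left_mono, auto intro: mult_right_mono)
  qed auto
  finally show ?case by (simp add: algebra_simps)
qed simp

lemma norm_qpow: "norm (qpow t x) = exp (- (2 * pi * x * Im t))"
  by (simp add: qpow_def)

lemma qpow_nonzero [simp]: "qpow t x \<noteq> 0"
  by (simp add: qpow_def)

text \<open>The strip meets every class modulo the period t, so a zero in it is a zero up to
  translation. Since the error is bounded by a multiple of the leading term, theta_1 can vanish
  there only together with the sine.\<close>

lemma norm_jtheta1_minus_leading: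
  assumes t: "Im t > 0" and x: "norm (nome t) \<le> 1 / 12" and z: "\<bar>Im z\<bar> \<le> Im t / 2"
  shows "norm (jtheta1 z t - 2 * qpow t (1 / 8) * sin (of_real pi * z)) \<le>
           4 * norm (nome t) * norm (2 * qpow t (1 / 8) * sin (of_real pi * z))"
proof -
  let ?f = "\<lambda>n. (-1) ^ n * qpow t ((real n + 1/2)\<^sup>2 / 2) * sin (of_nat (2*n+1) * of_real pi * z)"
  define A where "A = norm (qpow t (1 / 8) * sin (of_real pi * z))"
  define x where "x = norm (nome t)"
  have x': "0 \<le> x" "x \<le> 1 / 12" using x by (auto simp: x_def)
  note s = jtheta1_summable[OF t, of z]
  have "jtheta1 z t - 2 * qpow t (1 / 8) * sin (of_real pi * z) = 2 * (\<Sum>n. ?f (Suc n))"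
    unfolding suminf_split_head[OF s] by (simp add: jtheta1_def power2_eq_square algebra_simps)
  also have "norm \<dots> = 2 * norm (\<Sum>n. ?f (Suc n))" by (simp add: norm_mult)
  also have "norm (\<Sum>n. ?f (Suc n)) \<le> (\<Sum>n. A * (3 * x) ^ Suc n)"
  proof (rule norm_suminf_le)
    fix n
    have "norm (?f (Suc n)) = exp (- (pi * (real (Suc n) + 1/2)\<^sup>2 * Im t)) * norm (sin (of_nat (2*Suc n+1) * (of_real pi * z)))"
      by (simp add: norm_mult norm_power norm_qpow mult.assoc)
    also have "\<dots> \<le> exp (- (pi * (real (Suc n) + 1/2)\<^sup>2 * Im t)) *
        (real (2*Suc n+1) * norm (sin (of_real pi * z)) * exp (real (2*Suc n) * \<bar>Im (of_real pi * z)\<bar>))"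
      by (intro mult_left_mono norm_sin_odd_multiple_le) auto
    also have "\<dots> \<le> exp (- (pi * (real (Suc n) + 1/2)\<^sup>2 * Im t)) *
        (3 ^ Suc n * norm (sin (of_real pi * z)) * exp (real (2*Suc n) * (pi * Im t / 2)))"
    proof (intro mult_left_mono mult_mono)
      show "real (2*Suc n+1) \<le> 3 ^ Suc n" by (induction n) auto
      have "pi * \<bar>Im z\<bar> \<le> pi * (Im t / 2)" by (intro mult_left_mono z) auto
      then have "real (2*Suc n) * \<bar>Im (of_real pi * z)\<bar> \<le> real (2*Suc n) * (pi * Im t / 2)"
        by (intro mult_left_mono) (auto simp: abs_mult)
      then show "exp (real (2*Suc n) * \<bar>Im (of_real pi * z)\<bar>) \<le> exp (real (2*Suc n) * (pi * Im t / 2))"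
        by simp
    qed auto
    also have "\<dots> = exp (- (pi * (real (Suc n) + 1/2)\<^sup>2 * Im t) + real (2*Suc n) * (pi * Im t / 2)) *
        (3 ^ Suc n * norm (sin (of_real pi * z)))"
      unfolding exp_add by (simp only: mult_ac)
    \<comment> \<open>With k = n + 1 this is (k + 1/2)^2 - k = k^2 + 1/4: on the strip the growth of
      the sine costs just the linear term of the square, so a factor |nome|^(k^2) remains.\<close>
    also have "- (pi * (real (Suc n) + 1/2)\<^sup>2 * Im t) + real (2*Suc n) * (pi * Im t / 2) =
        - (2 * pi * (1 / 8) * Im t) + real ((Suc n)\<^sup>2) * (- (pi * Im t))"
      by (simp add: power2_eq_square field_simps)
    also have "exp \<dots> * (3 ^ Suc n * norm (sin (of_real pi * z))) = A * 3 ^ Suc n * x ^ ((Suc n)\<^sup>2)"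
      unfolding exp_add exp_of_nat_mult A_def x_def norm_mult norm_qpow norm_nome by (simp add: mult_ac)
    also have "\<dots> \<le> A * 3 ^ Suc n * x ^ Suc n"
      using x' by (intro mult_left_mono power_decreasing) (auto simp: A_def power2_eq_square)
    finally show "norm (?f (Suc n)) \<le> A * (3 * x) ^ Suc n" by (simp only: power_mult_distrib mult_ac)
  next
    show "summable (\<lambda>n. A * (3 * x) ^ Suc n)"
      by (intro summable_mult, subst summable_Suc_iff, intro summable_geometric, use x' in simp)
  qed
  also have "(\<Sum>n. A * (3 * x) ^ Suc n) = A * (3 * x / (1 - 3 * x))"
    using sums_mult[OF geometric_sums[of "3 * x"], of "A * (3 * x)"] x'
    by (intro sums_unique[symmetric]) (simp add: mult_ac)
  also have "\<dots> \<le> A * (4 * x)"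
  proof (intro mult_left_mono)
    \<comment> \<open>The origin of the bound 1/12: for x > 0 this inequality amounts to 12 x <=
      1.\<close>
    have "3 * x \<le> 4 * x * (1 - 3 * x)"
      using mult_right_mono[of x "1 / 12" "12 * x"] x' by (simp add: algebra_simps)
    then show "3 * x / (1 - 3 * x) \<le> 4 * x" using x' by (simp add: divide_le_eq)
  qed (simp add: A_def)
  finally show ?thesis by (simp add: A_def x_def norm_mult mult_ac)
qed

text \<open>At real arguments the cosines are bounded by 1. The cases y = 0 and y = 1/2 give
  theta_3(0) and theta_4(0).\<close>

lemma norm_jtheta3_minus_1:
  assumes t: "Im t > 0" and x: "norm (nome t) \<le> 1 / 12"
  shows "norm (jtheta3 (of_real y) t - 1) \<le> 4 * norm (nome t)"
proof -
  let ?f = "\<lambda>n. qpow t ((real (Suc n))\<^sup>2 / 2) * cos (of_nat (2 * Suc n) * of_real pi * of_real y)"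
  define x where "x = norm (nome t)"
  have x': "0 \<le> x" "x \<le> 1 / 12" using x by (auto simp: x_def)
  have "norm (jtheta3 (of_real y) t - 1) = 2 * norm (\<Sum>n. ?f n)"
    by (simp add: jtheta3_def norm_mult)
  also have "norm (\<Sum>n. ?f n) \<le> (\<Sum>n. x ^ Suc n)"
  proof (rule norm_suminf_le)
    fix n
    have "norm (?f n) \<le> norm (qpow t ((real (Suc n))\<^sup>2 / 2)) * 1"
      unfolding norm_mult using norm_cos_le_exp[of "of_nat (2 * Suc n) * of_real pi * of_real y"]
      by (intro mult_left_mono) auto
    also have "\<dots> = exp (real ((Suc n)\<^sup>2) * (- (pi * Im t)))"
      by (simp add: norm_qpow mult_ac)
    also have "\<dots> = x ^ ((Suc n)\<^sup>2)" unfolding exp_of_nat_mult x_def norm_nome by simp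
    also have "\<dots> \<le> x ^ Suc n"
      using x' by (intro power_decreasing) (auto simp: power2_eq_square)
    finally show "norm (?f n) \<le> x ^ Suc n" .
  next
    show "summable (\<lambda>n. x ^ Suc n)" using x' by (subst summable_Suc_iff) (auto intro!: summable_geometric)
  qed
  also have "(\<Sum>n. x ^ Suc n) = x / (1 - x)"
    using sums_mult[OF geometric_sums[of x], of x] x' by (intro sums_unique[symmetric]) simp
  also have "\<dots> \<le> 2 * x"
  proof -
    have "x \<le> 2 * x * (1 - x)" using mult_right_mono[of x "1 / 12" x] x' by (simp add: algebra_simps)
    then show ?thesis using x' by (simp add: divide_le_eq)
  qed
  finally show ?thesis by (simp add: x_def)
qed

text \<open>Doubling t squares the nome, so finitely many doublings reach the region of
  \<open>base\<close>, and \<open>step\<close> leads back to t.\<close>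

lemma half_plane_doubling_induct [consumes 1, case_names small double]:
  assumes "Im t > 0"
    and base: "\<And>t. Im t > 0 \<Longrightarrow> norm (nome t) \<le> 1 / 12 \<Longrightarrow> P t"
    and step: "\<And>t. Im t > 0 \<Longrightarrow> P (2 * t) \<Longrightarrow> P t"
  shows "P t"
proof -
  obtain n where n: "ln 12 / (pi * Im t) < 2 ^ n" using real_arch_pow[of 2] by auto
  then have "ln 12 \<le> pi * 2 ^ n * Im t" using assms(1) by (simp add: divide_less_eq mult_ac)
  then show ?thesis using assms(1)
  proof (induction n arbitrary: t)
    case 0
    then have "norm (nome t) \<le> exp (- ln 12)" by (simp add: norm_nome)
    then show ?case using 0 base by (simp add: exp_minus)
  next
    case (Suc n)
    then show ?case using Suc.IH[of "2 * t"] step[of t] by (simp add: mult_ac)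
  qed
qed

section \<open>The zeros of theta_1\<close>

definition period_lattice :: "complex \<Rightarrow> complex set" where
  "period_lattice t = {of_int m * t + of_int n | m n. True}"

text \<open>The value type is arbitrary because P will be a truth value (vanishing, absence of a
  pole) or a norm: these are invariant where the function itself picks up a multiplier.\<close>

lemma invariant_int_multiple:
  fixes P :: "complex \<Rightarrow> 'a" and c :: complex
  assumes "\<And>z. P (z + c) = P z"
  shows "P (z + of_int m * c) = P z"
proof (induction m arbitrary: z rule: int_induct[where k = 0])
  case (step1 i)
  then show ?case using assms[of "z + of_int i * c"] by (simp add: algebra_simps)
next
  case (step2 i)
  then show ?case using assms[of "z + of_int (i - 1) * c"] by (simp add: algebra_simps)
qed simp

lemma jtheta1_shift_eq_0_iff:
  assumes "Im t > 0"
  shows "jtheta1 (z + of_int m * t + of_int n) t = 0 \<longleftrightarrow> jtheta1 z t = 0"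
  using invariant_int_multiple[of "\<lambda>z. jtheta1 z t = 0" 1 "z + of_int m * t" n]
    invariant_int_multiple[of "\<lambda>z. jtheta1 z t = 0" t z m]
  by (simp add: jtheta1_plus_1 jtheta1_plus_tau assms)

lemma jtheta1_0 [simp]: "Im t > 0 \<Longrightarrow> jtheta1 0 t = 0"
  using jtheta1_minus[of t 0] by simp

lemma half_notin_period_lattice:
  assumes "Im t > 0"
  shows "1 / 2 \<notin> period_lattice t"
proof
  assume "1 / 2 \<in> period_lattice t"
  then obtain m n where *: "1 / 2 = of_int m * t + of_int n" by (auto simp: period_lattice_def)
  have "m = 0" using arg_cong[OF *, of Im] assms by simp
  then have "real_of_int (2 * n) = 1" using arg_cong[OF *, of Re] by simp
  then have "2 * n = 1" by linarith
  then show False by presburger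
qed

text \<open>The claims must descend together: nonvanishing of the constants at \<open>2 * t\<close>
  lets the Landen identities be used, and the zeros of theta_1 at \<open>2 * t\<close> control
  theta_2(0, t) = theta_1(1/2, t).\<close>

lemma theta_nonvanishing:
  assumes "Im t > 0"
  shows "jtheta3 0 t \<noteq> 0 \<and> jtheta4 0 t \<noteq> 0 \<and> (\<forall>z. jtheta1 z t = 0 \<longrightarrow> z \<in> period_lattice t)"
  using assms
proof (induction rule: half_plane_doubling_induct)
  case (small t)
  have nz: "norm (w - 1) \<le> 4 * norm (nome t) \<Longrightarrow> w \<noteq> 0" for w :: complex
    using small(2) by auto
  show ?case
  proof (intro conjI allI impI)
    show "jtheta3 0 t \<noteq> 0" using nz[OF norm_jtheta3_minus_1[OF small, of 0]] by simp
    show "jtheta4 0 t \<noteq> 0" using nz[OF norm_jtheta3_minus_1[OF small, of "1 / 2"]] by (simp add: jtheta4_eq_jtheta3)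
    fix z assume z: "jtheta1 z t = 0"
    \<comment> \<open>Subtracting the nearest multiple of t brings z into the strip of
      \<open>norm_jtheta1_minus_leading\<close>.\<close>
    define m where "m = round (Im z / Im t)"
    define w where "w = z + of_int (- m) * t + of_int 0"
    have w0: "jtheta1 w t = 0" unfolding w_def jtheta1_shift_eq_0_iff[OF small(1)] by (rule z)
    have "Im w = (Im z / Im t - of_int m) * Im t" using small(1) by (simp add: w_def field_simps)
    then have "\<bar>Im w\<bar> = \<bar>of_int m - Im z / Im t\<bar> * Im t"
      using small(1) by (simp add: abs_mult abs_minus_commute)
    also have "\<dots> \<le> 1 / 2 * Im t"
      unfolding m_def using small(1) by (intro mult_right_mono of_int_round_abs_le) auto
    finally have "\<bar>Im w\<bar> \<le> Im t / 2" by simp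
    from norm_jtheta1_minus_leading[OF small this]
    have "norm (2 * qpow t (1 / 8) * sin (of_real pi * w)) \<le> 4 * norm (nome t) * norm (2 * qpow t (1 / 8) * sin (of_real pi * w))"
      unfolding w0 by simp
    \<comment> \<open>The leading term is thus at most a third of itself in norm, so it is
      0.\<close>
    moreover have "4 * norm (nome t) * norm (2 * qpow t (1 / 8) * sin (of_real pi * w)) \<le>
        1 / 3 * norm (2 * qpow t (1 / 8) * sin (of_real pi * w))"
      using small(2) by (intro mult_right_mono) auto
    ultimately have "norm (2 * qpow t (1 / 8) * sin (of_real pi * w)) \<le> 0" by linarith
    then have "sin (of_real pi * w) = 0" by simp
    then obtain n :: int where "of_real pi * w = of_real (of_int n * pi)" by (auto simp: sin_eq_0)
    then have "w = of_int n" by simp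
    then have "z = of_int m * t + of_int n" by (simp add: w_def algebra_simps)
    then show "z \<in> period_lattice t" by (auto simp: period_lattice_def)
  qed
next
  case (double t)
  have t2: "Im (2 * t) > 0" using double(1) by simp
  from double(2) have nz: "jtheta3 0 (2 * t) \<noteq> 0" "jtheta4 0 (2 * t) \<noteq> 0"
    and L: "\<And>z. jtheta1 z (2 * t) = 0 \<Longrightarrow> z \<in> period_lattice (2 * t)" by auto
  have "jtheta1 (1 / 2) (2 * t) \<noteq> 0" using L half_notin_period_lattice[OF t2] by blast
  then have "jtheta2 0 t \<noteq> 0"
    using landen_jtheta2[OF double(1)] nz by (auto simp: jtheta2_eq_jtheta1)
  then have half: "jtheta1 (1 / 2) t \<noteq> 0" by (simp add: jtheta2_eq_jtheta1)
  show ?case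
  proof (intro conjI allI impI)
    show "jtheta3 0 t \<noteq> 0" "jtheta4 0 t \<noteq> 0" using landen_jtheta4[OF double(1)] nz by auto
    fix z assume z: "jtheta1 z t = 0"
    then have "jtheta1 (2 * z) (2 * t) = 0" using landen_jtheta1[OF double(1), of z] nz by simp
    then obtain m k where mk: "2 * z = of_int m * (2 * t) + of_int k" using L[of "2 * z"] by (auto simp: period_lattice_def)
    \<comment> \<open>The zeros at \<open>2 * t\<close> put z into the lattice of t or into its
      translate by 1/2. Odd k is the translate, where theta_1 does not vanish because theta_2(0, t)
      is nonzero.\<close>
    have "even k"
    proof (rule ccontr)
      assume "odd k"
      then obtain l where "k = 2 * l + 1" by (auto elim: oddE)
      then have "z = 1 / 2 + of_int m * t + of_int l" using mk by (simp add: field_simps)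
      then show False using z half jtheta1_shift_eq_0_iff[OF double(1)] by blast
    qed
    then obtain l where "k = 2 * l" by auto
    then have "2 * z = 2 * (of_int m * t + of_int l)" using mk by (simp add: algebra_simps)
    then have "z = of_int m * t + of_int l" by (simp only: mult_cancel_left) simp
    then show "z \<in> period_lattice t" by (auto simp: period_lattice_def)
  qed
qed

lemma jtheta1_eq_0_iff:
  assumes "Im t > 0"
  shows "jtheta1 z t = 0 \<longleftrightarrow> z \<in> period_lattice t"
  using theta_nonvanishing[OF assms] jtheta1_shift_eq_0_iff[OF assms, of 0] assms
  by (auto simp: period_lattice_def)

lemma jtheta_nonzero_at_0:
  assumes "Im t > 0"
  shows "jtheta2 0 t \<noteq> 0" "jtheta3 0 t \<noteq> 0" "jtheta4 0 t \<noteq> 0"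
  using theta_nonvanishing[OF assms] jtheta1_eq_0_iff[OF assms, of "1 / 2"] half_notin_period_lattice[OF assms]
  by (auto simp: jtheta2_eq_jtheta1)

section \<open>Jacobi's formula for theta_1'(0)\<close>

lemma landen_jtheta1_deriv:
  assumes "Im t > 0"
  shows "2 * deriv (\<lambda>z. jtheta1 z (2 * t)) 0 * jtheta4 0 (2 * t) = deriv (\<lambda>z. jtheta1 z t) 0 * jtheta2 0 t"
proof -
  have t2: "Im (2 * t) > 0" using assms by simp
  note d = holomorphic_derivI[OF jtheta_holomorphic(1) open_UNIV UNIV_I]
    holomorphic_derivI[OF jtheta_holomorphic(2) open_UNIV UNIV_I]
  have "((\<lambda>z. jtheta1 (2 * z) (2 * t) * jtheta4 0 (2 * t)) has_field_derivative
      deriv (\<lambda>z. jtheta1 z (2 * t)) 0 * 2 * jtheta4 0 (2 * t)) (at 0)"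
    using DERIV_chain2[of "\<lambda>z. jtheta1 z (2 * t)" "deriv (\<lambda>z. jtheta1 z (2 * t)) 0" "\<lambda>z. 2 * z" 0 2 UNIV]
      d(1)[OF t2, of 0] by (intro DERIV_cmult_right) (auto intro!: derivative_eq_intros)
  moreover have "((\<lambda>z. jtheta1 z t * jtheta2 z t) has_field_derivative
      deriv (\<lambda>z. jtheta1 z t) 0 * jtheta2 0 t) (at 0)"
    using DERIV_mult[OF d(1)[OF assms, of 0] d(2)[OF assms, of 0]] assms by simp
  ultimately show ?thesis
    unfolding landen_jtheta1[OF assms] by (auto dest: DERIV_unique simp: mult_ac)
qed

text \<open>The estimate of \<open>norm_jtheta1_minus_leading\<close> is divided by z before z tends
  to 0; it survives the division because its error also carries the factor sin(pi z).\<close>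

lemma norm_deriv_jtheta1_minus_leading:
  assumes t: "Im t > 0" and x: "norm (nome t) \<le> 1 / 12"
  shows "norm (deriv (\<lambda>z. jtheta1 z t) 0 - 2 * qpow t (1 / 8) * of_real pi) \<le>
           4 * norm (nome t) * norm (2 * qpow t (1 / 8) * of_real pi)"
proof (rule tendsto_le)
  let ?A = "\<lambda>z. 2 * qpow t (1 / 8) * (sin (of_real pi * z) / z)"
  have l1: "(\<lambda>z. jtheta1 z t / z) \<midarrow>0\<rightarrow> deriv (\<lambda>z. jtheta1 z t) 0"
    using holomorphic_derivI[OF jtheta_holomorphic(1)[OF t] open_UNIV UNIV_I, of 0 UNIV] t
    by (simp add: DERIV_def)
  have "((\<lambda>z. sin (of_real pi * z)) has_field_derivative of_real pi) (at (0 :: complex))"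
    by (auto intro!: derivative_eq_intros)
  then have l2: "(\<lambda>z. sin (of_real pi * z) / z) \<midarrow>0\<rightarrow> (of_real pi :: complex)"
    by (simp add: DERIV_def)
  show "((\<lambda>z. norm (jtheta1 z t / z - ?A z)) \<longlongrightarrow>
      norm (deriv (\<lambda>z. jtheta1 z t) 0 - 2 * qpow t (1 / 8) * of_real pi)) (at 0)"
    "((\<lambda>z. 4 * norm (nome t) * norm (?A z)) \<longlongrightarrow>
      4 * norm (nome t) * norm (2 * qpow t (1 / 8) * of_real pi)) (at 0)"
    by (intro tendsto_norm tendsto_diff tendsto_mult tendsto_const l1 l2)+
  have "eventually (\<lambda>z. z \<in> ball 0 (Im t / 2) - {0}) (at (0 :: complex))"
    using t by (intro eventually_at_in_open) auto
  then show "eventually (\<lambda>z. norm (jtheta1 z t / z - ?A z) \<le> 4 * norm (nome t) * norm (?A z)) (at 0)"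
  proof eventually_elim
    case (elim z)
    then have "\<bar>Im z\<bar> \<le> Im t / 2" using abs_Im_le_cmod[of z] by auto
    from divide_right_mono[OF norm_jtheta1_minus_leading[OF t x this], of "norm z"] elim
    have "norm ((jtheta1 z t - 2 * qpow t (1 / 8) * sin (of_real pi * z)) / z) \<le>
       4 * norm (nome t) * norm (2 * qpow t (1 / 8) * sin (of_real pi * z) / z)"
      by (simp add: norm_divide)
    then show ?case by (simp add: diff_divide_distrib)
  qed
qed simp

text \<open>By the Landen identities the ratio of the two sides is unchanged when \<open>t\<close> is doubled,
  and it tends to 1 as the nome tends to 0.\<close>

theorem jacobi_derivative_formula:
  assumes t: "Im t > 0"
  shows "deriv (\<lambda>z. jtheta1 z t) 0 = of_real pi * jtheta2 0 t * jtheta3 0 t * jtheta4 0 t"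
proof -
  define d where "d = (\<lambda>t. deriv (\<lambda>z. jtheta1 z t) 0)"
  define R where "R = (\<lambda>t. d t / (of_real pi * jtheta2 0 t * jtheta3 0 t * jtheta4 0 t))"
  have R2: "R (2 * t) = R t" if t: "Im t > 0" for t
  proof -
    have t2: "Im (2 * t) > 0" using t by simp
    have d2: "d (2 * t) = d t * jtheta2 0 t / (2 * jtheta4 0 (2 * t))"
      using landen_jtheta1_deriv[OF t] jtheta_nonzero_at_0[OF t2] by (simp add: d_def field_simps)
    have "R (2 * t) = d t * jtheta2 0 t / (of_real pi * (2 * jtheta2 0 (2 * t) * jtheta3 0 (2 * t)) * (jtheta4 0 (2 * t))\<^sup>2)"
      unfolding R_def d2 by (simp add: power2_eq_square mult_ac)
    also have "\<dots> = R t"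
      unfolding landen_jtheta2[OF t] landen_jtheta4[OF t] R_def
      using jtheta_nonzero_at_0[OF t] by (simp add: power2_eq_square)
    finally show ?thesis .
  qed
  have Im_n: "Im (2 ^ n * t) > 0" for n using t by simp
  have Rn: "R (2 ^ n * t) = R t" for n
    by (induction n) (use R2 Im_n in \<open>auto simp: mult.assoc\<close>)
  define x where "x = (\<lambda>n. norm (nome (2 ^ n * t)))"
  have x: "x \<longlonglongrightarrow> 0"
  proof -
    have "norm (x n) \<le> norm (nome t) ^ n" for n
    proof -
      have "x n = exp (real (2 ^ n) * (- (pi * Im t)))" by (simp add: x_def norm_nome mult_ac)
      also have "\<dots> = norm (nome t) ^ (2 ^ n)" unfolding exp_of_nat_mult by (simp add: norm_nome)
      also have "\<dots> \<le> norm (nome t) ^ n"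
        using less_exp[of n] norm_nome_less_1[OF t] by (intro power_decreasing) auto
      finally show ?thesis by (simp add: x_def)
    qed
    moreover have "(\<lambda>n. norm (nome t) ^ n) \<longlonglongrightarrow> 0"
      using norm_nome_less_1[OF t] by (intro LIMSEQ_realpow_zero) auto
    ultimately show ?thesis by (rule Lim_null_comparison[OF always_eventually[OF allI]])
  qed
  have conv: "(\<lambda>n. F (2 ^ n * t)) \<longlonglongrightarrow> 1"
    if "\<And>t. Im t > 0 \<Longrightarrow> norm (nome t) \<le> 1 / 12 \<Longrightarrow> norm (F t - 1) \<le> 4 * norm (nome t)" for F :: "complex \<Rightarrow> complex"
  proof -
    have "eventually (\<lambda>n. x n < 1 / 12) sequentially" by (rule order_tendstoD[OF x]) simp
    then have "eventually (\<lambda>n. norm (F (2 ^ n * t) - 1) \<le> 4 * x n) sequentially"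
      by eventually_elim (use that Im_n in \<open>auto simp: x_def\<close>)
    moreover have "(\<lambda>n. 4 * x n) \<longlonglongrightarrow> 4 * 0" by (intro tendsto_intros x)
    ultimately have "(\<lambda>n. F (2 ^ n * t) - 1) \<longlonglongrightarrow> 0"
      unfolding mult_zero_right by (rule Lim_null_comparison)
    then show ?thesis by (simp add: LIM_zero_iff)
  qed
  have normalise: "norm (u / A - 1) \<le> e" if "norm (u - A) \<le> e * norm A" "A \<noteq> 0" for u A :: complex and e
  proof -
    have "u / A - 1 = (u - A) / A" using that(2) by (simp add: diff_divide_distrib)
    then have "norm (u / A - 1) = norm (u - A) / norm A" by (simp only: norm_divide)
    also have "\<dots> \<le> e" using that by (subst pos_divide_le_eq) auto
    finally show ?thesis .
  qed
  \<comment> \<open>Both theta_1'(0) and theta_2(0) tend to 0 along the doublings; this common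
    leading factor is divided out of each so that their ratio has a computable limit.\<close>
  let ?Q = "\<lambda>t. 2 * qpow t (1 / 8)"
  have l1: "(\<lambda>n. d (2 ^ n * t) / (?Q (2 ^ n * t) * of_real pi)) \<longlonglongrightarrow> 1"
    by (rule conv, rule normalise) (use norm_deriv_jtheta1_minus_leading in \<open>auto simp: d_def\<close>)
  have l2: "(\<lambda>n. jtheta2 0 (2 ^ n * t) / ?Q (2 ^ n * t)) \<longlonglongrightarrow> 1"
  proof (rule conv, rule normalise)
    fix t assume "Im t > 0" "norm (nome t) \<le> 1 / 12"
    from norm_jtheta1_minus_leading[OF this, of "1 / 2"] this(1)
    show "norm (jtheta2 0 t - ?Q t) \<le> 4 * norm (nome t) * norm (?Q t)"
      by (simp add: jtheta2_eq_jtheta1)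
  qed auto
  have l3: "(\<lambda>n. jtheta3 0 (2 ^ n * t)) \<longlonglongrightarrow> 1" using norm_jtheta3_minus_1[of _ 0] by (intro conv) simp
  have l4: "(\<lambda>n. jtheta4 0 (2 ^ n * t)) \<longlonglongrightarrow> 1"
    using norm_jtheta3_minus_1[of _ "1 / 2"] by (intro conv) (simp add: jtheta4_eq_jtheta3)
  have "(\<lambda>n. d (2 ^ n * t) / (?Q (2 ^ n * t) * of_real pi) / (jtheta2 0 (2 ^ n * t) / ?Q (2 ^ n * t) *
      jtheta3 0 (2 ^ n * t) * jtheta4 0 (2 ^ n * t))) \<longlonglongrightarrow> 1 / (1 * 1 * 1)"
    by (intro tendsto_divide tendsto_mult l1 l2 l3 l4) simp
  moreover have "d (2 ^ n * t) / (?Q (2 ^ n * t) * of_real pi) / (jtheta2 0 (2 ^ n * t) / ?Q (2 ^ n * t) *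
      jtheta3 0 (2 ^ n * t) * jtheta4 0 (2 ^ n * t)) = R (2 ^ n * t)" for n
    by (simp add: R_def field_simps)
  ultimately have "R t = 1" by (simp only: Rn) (simp add: LIMSEQ_const_iff)
  then show ?thesis using jtheta_nonzero_at_0[OF t] by (simp add: R_def d_def field_simps)
qed

section \<open>Jacobi functions as theta quotients\<close>

lemma closed_period_lattice: "Im t > 0 \<Longrightarrow> closed (period_lattice t)"
proof -
  assume t: "Im t > 0"
  have "period_lattice t = (\<lambda>z. jtheta1 z t) -` {0}" using jtheta1_eq_0_iff[OF t] by auto
  also have "closed \<dots>"
    by (intro continuous_closed_vimage) (use jtheta_holomorphic(1)[OF t, of UNIV] in
      \<open>auto dest!: holomorphic_on_imp_continuous_on simp: continuous_on_eq_continuous_at\<close>)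
  finally show ?thesis .
qed

lemma eventually_notin_period_lattice:
  assumes "Im t > 0"
  shows "eventually (\<lambda>z. z - p \<notin> period_lattice t) (at q)"
proof -
  have "(\<lambda>z. jtheta1 (z - p) t) holomorphic_on UNIV"
    using holomorphic_on_compose[OF _ jtheta_holomorphic(1)[OF assms], of "\<lambda>z. z - p" UNIV]
    by (simp add: o_def holomorphic_intros)
  from non_zero_neighbour_alt[OF this, of q "1 / 2 + p"] show ?thesis
    using jtheta1_eq_0_iff[OF assms] half_notin_period_lattice[OF assms] by (simp add: connected_UNIV)
qed

text \<open>At a zero of q the quotient has a genuine pole, where \<open>remove_sings\<close>
  returns 0; that agrees with division by zero on the right.\<close>

lemma remove_sings_quotient:
  assumes p: "p holomorphic_on UNIV" and q: "q holomorphic_on UNIV"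
    and nz: "q z0 \<noteq> 0" and no_common: "\<And>z. q z = 0 \<Longrightarrow> p z \<noteq> 0"
  shows "remove_sings (\<lambda>w. p w / q w) z = p z / q z"
proof (cases "q z = 0")
  case False
  have "(\<lambda>w. p w / q w) analytic_on {z}"
    using p q False by (intro analytic_on_divide) (auto simp: analytic_at intro!: exI[of _ UNIV])
  then show ?thesis by simp
next
  case True
  have cont: "isCont p z" "isCont q z"
    using p q by (auto dest!: holomorphic_on_imp_continuous_on simp: continuous_on_eq_continuous_at)
  have "is_pole (\<lambda>w. p w / q w) z"
  proof (rule is_pole_divide)
    show "filterlim q (at 0) (at z)"
      using cont(2) True non_zero_neighbour_alt[OF q open_UNIV connected_UNIV UNIV_I UNIV_I nz]
      by (auto simp: filterlim_at isCont_def)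
  qed (use cont no_common True in auto)
  then show ?thesis using True by simp
qed

text \<open>Here r will be theta_4, the common denominator of sn, cn and dn. Its zeros are isolated
  and \<open>remove_sings\<close> depends only on a punctured neighbourhood, so r cancels even at
  them.\<close>

lemma remove_sings_quotient_cancel:
  assumes "p holomorphic_on UNIV" "q holomorphic_on UNIV" "r holomorphic_on UNIV"
    and "q z0 \<noteq> 0" "r z1 \<noteq> 0" "A \<noteq> 0" "B \<noteq> 0" "\<And>z. q z = 0 \<Longrightarrow> p z \<noteq> 0"
  shows "remove_sings (\<lambda>w. (A * (p w / r w)) / (B * (q w / r w))) z = A / B * (p z / q z)"
proof -
  have ev: "eventually (\<lambda>w. r w \<noteq> 0) (at z)"
    using non_zero_neighbour_alt[OF assms(3) open_UNIV connected_UNIV UNIV_I UNIV_I assms(5)] by simp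
  have "remove_sings (\<lambda>w. (A * (p w / r w)) / (B * (q w / r w))) z = remove_sings (\<lambda>w. (A * p w) / (B * q w)) z"
    by (rule remove_sings_cong[OF eventually_mono[OF ev]]) auto
  also have "\<dots> = (A * p z) / (B * q z)"
    by (rule remove_sings_quotient[where ?z0.0 = z0]) (use assms in \<open>auto intro!: holomorphic_intros\<close>)
  finally show ?thesis by simp
qed

context
  fixes t :: complex
  assumes t: "Im t > 0"
begin

lemma jacobi_K_nonzero: "jacobi_K t \<noteq> 0"
  using jtheta_nonzero_at_0[OF t] by (simp add: jacobi_K_def)

lemma jtheta_scaled_holomorphic:
  "(\<lambda>w. jtheta1 (w / c) t) holomorphic_on UNIV" "(\<lambda>w. jtheta2 (w / c) t) holomorphic_on UNIV"
  "(\<lambda>w. jtheta3 (w / c) t) holomorphic_on UNIV" "(\<lambda>w. jtheta4 (w / c) t) holomorphic_on UNIV"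
proof -
  have "(\<lambda>w. w / c) holomorphic_on UNIV" by (auto intro!: holomorphic_intros)
  note h = holomorphic_on_compose[OF this jtheta_holomorphic(1)[OF t], unfolded o_def]
    holomorphic_on_compose[OF this jtheta_holomorphic(2)[OF t], unfolded o_def]
    holomorphic_on_compose[OF this jtheta_holomorphic(3)[OF t], unfolded o_def]
    holomorphic_on_compose[OF this jtheta_holomorphic(4)[OF t], unfolded o_def]
  show "(\<lambda>w. jtheta1 (w / c) t) holomorphic_on UNIV" "(\<lambda>w. jtheta2 (w / c) t) holomorphic_on UNIV"
    "(\<lambda>w. jtheta3 (w / c) t) holomorphic_on UNIV" "(\<lambda>w. jtheta4 (w / c) t) holomorphic_on UNIV"
    by (fact h)+
qed

text \<open>Vanishing is invariant under both periods although the functions are not, so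
  nonvanishing at 0 spreads over the lattice. It ensures that no zero of theta_1 is cancelled in cs,
  ds and ns.\<close>

lemma jtheta_nonzero_on_lattice:
  assumes "jtheta1 z t = 0"
  shows "jtheta2 z t \<noteq> 0" "jtheta3 z t \<noteq> 0" "jtheta4 z t \<noteq> 0"
proof -
  obtain m n where z: "z = of_int m * t + of_int n"
    using assms jtheta1_eq_0_iff[OF t] by (auto simp: period_lattice_def)
  have *: "F z \<noteq> 0" if "F 0 \<noteq> 0" "\<And>z. F (z + 1) = 0 \<longleftrightarrow> F z = 0" "\<And>z. F (z + t) = 0 \<longleftrightarrow> F z = 0"
    for F :: "complex \<Rightarrow> complex"
    using invariant_int_multiple[of "\<lambda>z. F z = 0" 1 "of_int m * t" n]
      invariant_int_multiple[of "\<lambda>z. F z = 0" t 0 m] that by (simp add: z)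
  note nz = jtheta_nonzero_at_0[OF t]
  show "jtheta2 z t \<noteq> 0"
    by (rule *[of "\<lambda>z. jtheta2 z t"]) (simp_all add: nz jtheta2_plus_1[OF t] jtheta2_plus_tau[OF t])
  show "jtheta3 z t \<noteq> 0"
    by (rule *[of "\<lambda>z. jtheta3 z t"]) (simp_all add: nz jtheta3_plus_1[OF t] jtheta3_plus_tau[OF t])
  show "jtheta4 z t \<noteq> 0"
    by (rule *[of "\<lambda>z. jtheta4 z t"]) (simp_all add: nz jtheta4_plus_1[OF t] jtheta4_plus_tau[OF t])
qed

lemma jtheta1_half_nonzero: "jtheta1 (1 / 2) t \<noteq> 0"
  using jtheta1_eq_0_iff[OF t] half_notin_period_lattice[OF t] by simp

lemma jacobi_f_conv_jtheta:
  shows "odd i \<Longrightarrow> even j \<Longrightarrow> jacobi_f i j z t = of_real pi * jtheta3 0 t * jtheta4 0 t * jtheta2 z t / jtheta1 z t"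
    and "odd i \<Longrightarrow> odd j \<Longrightarrow> jacobi_f i j z t = of_real pi * jtheta2 0 t * jtheta4 0 t * jtheta3 z t / jtheta1 z t"
    and "even i \<Longrightarrow> odd j \<Longrightarrow> jacobi_f i j z t = of_real pi * jtheta2 0 t * jtheta3 0 t * jtheta4 z t / jtheta1 z t"
proof -
  define c where "c = 2 * jacobi_K t"
  have c: "c \<noteq> 0" "c = of_real pi * (jtheta3 0 t)\<^sup>2"
    using jacobi_K_nonzero by (auto simp: c_def jacobi_K_def)
  note nz = jtheta_nonzero_at_0[OF t]
  \<comment> \<open>After rescaling by c, the points c/2 and 0 witness that theta_1 and theta_4 are
    not identically zero.\<close>
  have w1: "jtheta1 (c / 2 / c) t \<noteq> 0" using jtheta1_half_nonzero c by simp
  have w4: "jtheta4 (0 / c) t \<noteq> 0" using nz by simp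
  have cs: "jacobi_cs (c * z) t = jtheta4 0 t / jtheta2 0 t / (jtheta3 0 t / jtheta2 0 t) * (jtheta2 (c * z / c) t / jtheta1 (c * z / c) t)"
    unfolding jacobi_cs_def jacobi_cn_def jacobi_sn_def Let_def c_def[symmetric]
    by (rule remove_sings_quotient_cancel[OF jtheta_scaled_holomorphic(2,1,4), where ?z0.0 = "c / 2" and ?z1.0 = 0])
       (use w1 w4 nz jtheta_nonzero_on_lattice in auto)
  have ds: "jacobi_ds (c * z) t = jtheta4 0 t / jtheta3 0 t / (jtheta3 0 t / jtheta2 0 t) * (jtheta3 (c * z / c) t / jtheta1 (c * z / c) t)"
    unfolding jacobi_ds_def jacobi_dn_def jacobi_sn_def Let_def c_def[symmetric]
    by (rule remove_sings_quotient_cancel[OF jtheta_scaled_holomorphic(3,1,4), where ?z0.0 = "c / 2" and ?z1.0 = 0])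
       (use w1 w4 nz jtheta_nonzero_on_lattice in auto)
  have ns: "jacobi_ns (c * z) t = jtheta2 0 t * jtheta4 (c * z / c) t / (jtheta3 0 t * jtheta1 (c * z / c) t)"
  proof -
    have "jacobi_ns (c * z) t = remove_sings (\<lambda>w. (jtheta2 0 t * jtheta4 (w / c) t) / (jtheta3 0 t * jtheta1 (w / c) t)) (c * z)"
      unfolding jacobi_ns_def jacobi_sn_def Let_def c_def[symmetric] by simp
    also have "\<dots> = jtheta2 0 t * jtheta4 (c * z / c) t / (jtheta3 0 t * jtheta1 (c * z / c) t)"
      by (rule remove_sings_quotient[where ?z0.0 = "c / 2"])
         (use w1 nz jtheta_nonzero_on_lattice in \<open>auto intro!: holomorphic_intros jtheta_scaled_holomorphic\<close>)
    finally show ?thesis .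
  qed
  show "odd i \<Longrightarrow> even j \<Longrightarrow> jacobi_f i j z t = of_real pi * jtheta3 0 t * jtheta4 0 t * jtheta2 z t / jtheta1 z t"
    "odd i \<Longrightarrow> odd j \<Longrightarrow> jacobi_f i j z t = of_real pi * jtheta2 0 t * jtheta4 0 t * jtheta3 z t / jtheta1 z t"
    "even i \<Longrightarrow> odd j \<Longrightarrow> jacobi_f i j z t = of_real pi * jtheta2 0 t * jtheta3 0 t * jtheta4 z t / jtheta1 z t"
    unfolding jacobi_f_def Let_def c_def[symmetric] cs ds ns using nz
    by (auto simp: c(1)) (simp_all add: c(2) power2_eq_square)
qed

end

text \<open>What the reciprocity argument uses about a Jacobi function. The first index belongs to
  the period t, the second to 1; both enter only through a sign, so \<open>i * a + m * b\<close> can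
  serve as an index without reduction modulo 2.\<close>

locale sign_elliptic =
  fixes t :: complex and i j :: nat and f :: "complex \<Rightarrow> complex"
  assumes Im_t: "Im t > 0"
    and holomorphic_f: "f holomorphic_on - period_lattice t"
    and plus_1: "f (z + 1) = (-1) ^ j * f z"
    and plus_tau: "f (z + t) = (-1) ^ i * f z"
    and odd_fun: "f (- z) = - f z"
    and residue_0: "(\<lambda>z. z * f z) \<midarrow>0\<rightarrow> 1"

text \<open>The exponential factors of p and theta_1 cancel under z -> z + t and only signs remain.
  The prescribed value of \<open>c * p 0\<close> is theta_1'(0), by
  \<open>jacobi_derivative_formula\<close>, which normalises the residue to 1.\<close>

lemma sign_elliptic_jtheta_quotient:
  assumes t: "Im t > 0" and p: "p holomorphic_on UNIV" and even: "\<And>z. p (- z) = p z"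
    and p1: "\<And>z. p (z + 1) = - ((-1) ^ j * p z)"
    and ptau: "\<And>z. p (z + t) = - ((-1) ^ i * exp (- (of_real pi * \<i> * (t + 2 * z))) * p z)"
    and p0: "c * p 0 = of_real pi * jtheta2 0 t * jtheta3 0 t * jtheta4 0 t"
  shows "sign_elliptic t i j (\<lambda>z. c * p z / jtheta1 z t)"
proof
  show "(\<lambda>z. c * p z / jtheta1 z t) holomorphic_on - period_lattice t"
    using jtheta1_eq_0_iff[OF t]
    by (intro holomorphic_intros jtheta_holomorphic(1)[OF t] holomorphic_on_subset[OF p]) auto
  show "c * p (z + 1) / jtheta1 (z + 1) t = (-1) ^ j * (c * p z / jtheta1 z t)" for z
    by (simp add: p1 jtheta1_plus_1[OF t])
  show "c * p (z + t) / jtheta1 (z + t) t = (-1) ^ i * (c * p z / jtheta1 z t)" for z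
    by (simp add: ptau jtheta1_plus_tau[OF t])
  show "c * p (- z) / jtheta1 (- z) t = - (c * p z / jtheta1 z t)" for z
    by (simp add: even jtheta1_minus[OF t])
  let ?d = "of_real pi * jtheta2 0 t * jtheta3 0 t * jtheta4 0 t"
  have "(\<lambda>z. jtheta1 z t / z) \<midarrow>0\<rightarrow> ?d"
    using holomorphic_derivI[OF jtheta_holomorphic(1)[OF t] open_UNIV UNIV_I, of 0 UNIV] t
    by (simp add: DERIV_def jacobi_derivative_formula)
  moreover have "p \<midarrow>0\<rightarrow> p 0"
    using p by (auto dest!: holomorphic_on_imp_continuous_on simp: continuous_on_eq_continuous_at isCont_def)
  ultimately have "(\<lambda>z. c * p z / (jtheta1 z t / z)) \<midarrow>0\<rightarrow> c * p 0 / ?d"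
    using jtheta_nonzero_at_0[OF t] by (intro tendsto_intros) auto
  then show "(\<lambda>z. z * (c * p z / jtheta1 z t)) \<midarrow>0\<rightarrow> 1"
    using jtheta_nonzero_at_0[OF t] by (simp add: p0 mult_ac)
qed (fact t)

lemma sign_elliptic_jacobi_f:
  assumes t: "Im t > 0" and "odd i \<or> odd j"
  shows "sign_elliptic t i j (\<lambda>z. jacobi_f i j z t)"
proof -
  consider "odd i" "even j" | "odd i" "odd j" | "even i" "odd j" using assms(2) by blast
  then show ?thesis
  proof cases
    case 1
    show ?thesis unfolding jacobi_f_conv_jtheta(1)[OF t 1]
      by (rule sign_elliptic_jtheta_quotient[OF t jtheta_holomorphic(2)[OF t]])
         (use 1 in \<open>simp_all add: jtheta2_minus jtheta2_plus_1[OF t] jtheta2_plus_tau[OF t]\<close>)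
  next
    case 2
    show ?thesis unfolding jacobi_f_conv_jtheta(2)[OF t 2]
      by (rule sign_elliptic_jtheta_quotient[OF t jtheta_holomorphic(3)[OF t]])
         (use 2 in \<open>simp_all add: jtheta3_minus jtheta3_plus_1[OF t] jtheta3_plus_tau[OF t]\<close>)
  next
    case 3
    show ?thesis unfolding jacobi_f_conv_jtheta(3)[OF t 3]
      by (rule sign_elliptic_jtheta_quotient[OF t jtheta_holomorphic(4)[OF t]])
         (use 3 in \<open>simp_all add: jtheta4_minus jtheta4_plus_1[OF t] jtheta4_plus_tau[OF t]\<close>)
  qed
qed

section \<open>Partial fractions for sign-periodic functions\<close>

text \<open>The extension is \<open>remove_sings H\<close>, by Riemann's criterion in the form (z -
  p) H(z) -> 0; this form is convenient because the poles to be compared are tested by the same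
  product.\<close>

lemma removable_discrete_extension:
  assumes "closed P" and discrete: "\<And>p. p \<in> P \<Longrightarrow> eventually (\<lambda>z. z \<notin> P) (at p)"
    and H: "H holomorphic_on - P"
    and lim: "\<And>p. p \<in> P \<Longrightarrow> (\<lambda>z. (z - p) * H z) \<midarrow>p\<rightarrow> 0"
  obtains G where "G holomorphic_on UNIV" "\<And>z. z \<notin> P \<Longrightarrow> G z = H z"
proof
  have openP: "open (- P)" using assms(1) by (simp add: open_Compl)
  have H_an: "H analytic_on {z}" if "z \<notin> P" for z
    using H openP that by (auto simp: analytic_at)
  show eq: "remove_sings H z = H z" if "z \<notin> P" for z
    using H_an[OF that] by simp
  have "remove_sings H field_differentiable at p" for p
  proof (cases "p \<in> P")
    case False
    have "remove_sings H holomorphic_on - P" by (rule holomorphic_transform[OF H]) (simp add: eq)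
    then show ?thesis using openP False by (auto intro: holomorphic_on_imp_differentiable_at)
  next
    case True
    obtain S where S: "open S" "p \<in> S" "\<And>z. z \<in> S \<Longrightarrow> z \<noteq> p \<Longrightarrow> z \<notin> P"
      using discrete[OF True] unfolding eventually_at_topological by auto
    have "H holomorphic_on S - {p}" by (rule holomorphic_on_subset[OF H]) (use S in auto)
    with holomorphic_on_extend_lim[of H S p] lim[OF True] S
    obtain g where g: "g holomorphic_on S" "\<And>z. z \<in> S - {p} \<Longrightarrow> g z = H z"
      by (auto simp: interior_open)
    have "g \<midarrow>p\<rightarrow> g p"
      using g(1) S by (metis continuous_on_eq_continuous_at holomorphic_on_imp_continuous_on isCont_def)
    moreover have "eventually (\<lambda>z. g z = H z) (at p)"
      using S g(2) by (auto simp: eventually_at_topological)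
    ultimately have "H \<midarrow>p\<rightarrow> g p" by (metis tendsto_cong)
    then have "remove_sings H p = g p" by (rule remove_sings_eqI)
    then have "remove_sings H z = g z" if "z \<in> S" for z
      using that g(2)[of z] eq S(3)[of z] by (cases "z = p") auto
    then have "remove_sings H holomorphic_on S" using g(1) by (simp cong: holomorphic_cong)
    then show ?thesis using S by (auto intro: holomorphic_on_imp_differentiable_at)
  qed
  then show "remove_sings H holomorphic_on UNIV"
    by (auto simp: holomorphic_on_def field_differentiable_at_within)
qed

lemma entire_sign_periodic_eq_0:
  assumes t: "Im t > 0" and G: "G holomorphic_on UNIV"
    and G1: "\<And>z. G (z + 1) = (-1) ^ j * G z" and Gt: "\<And>z. G (z + t) = (-1) ^ i * G z"
    and "odd i \<or> odd j"
  shows "G z = (0 :: complex)"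
proof -
  define K where "K = (\<lambda>(x, y). of_real x * t + of_real y) ` ({0..1} \<times> {0..1 :: real})"
  have "compact K" unfolding K_def
    by (intro compact_continuous_image compact_Times continuous_intros)
       (auto simp: case_prod_unfold intro!: continuous_intros)
  then have "bounded (G ` K)"
    using holomorphic_on_imp_continuous_on[OF G]
    by (intro compact_imp_bounded compact_continuous_image) (auto intro: continuous_on_subset)
  then obtain M where M: "\<And>w. w \<in> K \<Longrightarrow> norm (G w) \<le> M" by (auto simp: bounded_iff)
  have "norm (G z) \<le> M" for z
  proof -
    \<comment> \<open>Real coordinates of z in the basis t, 1; their fractional parts give a point
      of the closed parallelogram K on which G has the same norm.\<close>
    define x y where "x = Im z / Im t" and "y = Re z - x * Re t"
    have z: "z = of_real x * t + of_real y" using t by (simp add: complex_eq_iff x_def y_def)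
    define w where "w = of_real (frac x) * t + of_real (frac y)"
    have "frac x \<in> {0..1}" "frac y \<in> {0..1}" using frac_lt_1[of x] frac_lt_1[of y] by auto
    then have "w \<in> K" by (auto simp: K_def w_def)
    have zw: "z = w + of_int \<lfloor>x\<rfloor> * t + of_int \<lfloor>y\<rfloor> * 1"
      by (simp add: w_def z frac_def algebra_simps)
    have "norm (G z) = norm (G w)" unfolding zw
      using invariant_int_multiple[of "\<lambda>z. norm (G z)" 1 "w + of_int \<lfloor>x\<rfloor> * t" "\<lfloor>y\<rfloor>"]
        invariant_int_multiple[of "\<lambda>z. norm (G z)" t w "\<lfloor>x\<rfloor>"]
      by (simp add: G1 Gt norm_mult norm_power)
    then show ?thesis using M[OF \<open>w \<in> K\<close>] by simp
  qed
  then have "bounded (range G)" by (auto simp: bounded_iff)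
  from Liouville_theorem[OF G this] obtain c where c: "\<And>z. G z = c" by (auto simp: constant_on_def)
  have "c = - c" using assms(5) G1[of 0] Gt[of 0] by (auto simp: c)
  then show ?thesis by (simp add: c)
qed

lemma period_lattice_add: "x \<in> period_lattice t \<Longrightarrow> y \<in> period_lattice t \<Longrightarrow> x + y \<in> period_lattice t"
proof -
  assume "x \<in> period_lattice t" "y \<in> period_lattice t"
  then obtain m n m' n' where "x = of_int m * t + of_int n" "y = of_int m' * t + of_int n'"
    by (auto simp: period_lattice_def)
  then have "x + y = of_int (m + m') * t + of_int (n + n')" by (simp add: algebra_simps)
  then show ?thesis unfolding period_lattice_def by blast
qed

lemma period_lattice_minus: "x \<in> period_lattice t \<Longrightarrow> - x \<in> period_lattice t"
proof -
  assume "x \<in> period_lattice t"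
  then obtain m n where "x = of_int m * t + of_int n" by (auto simp: period_lattice_def)
  then have "- x = of_int (- m) * t + of_int (- n)" by (simp add: algebra_simps)
  then show ?thesis unfolding period_lattice_def by blast
qed

lemma period_lattice_int: "of_int m * t + of_int n \<in> period_lattice t"
  by (auto simp: period_lattice_def)

lemma period_lattice_basics: "0 \<in> period_lattice t" "1 \<in> period_lattice t" "t \<in> period_lattice t"
  using period_lattice_int[of 0 t 0] period_lattice_int[of 0 t 1] period_lattice_int[of 1 t 0] by simp_all

lemma period_lattice_add_iff:
  assumes "l \<in> period_lattice t"
  shows "x + l \<in> period_lattice t \<longleftrightarrow> x \<in> period_lattice t"
  using period_lattice_add[OF _ assms, of x] period_lattice_add[OF _ period_lattice_minus[OF assms], of "x + l"]
  by auto

text \<open>The functional equation is required only near p and off p, since the function to which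
  this is applied satisfies it only outside its singular set.\<close>

lemma tendsto_pole_shift:
  fixes H :: "complex \<Rightarrow> complex"
  assumes "eventually (\<lambda>z. H (z + l) = s * H z) (at p)" and "s \<noteq> 0"
  shows "(\<lambda>z. (z - (p + l)) * H z) \<midarrow>p + l\<rightarrow> 0 \<longleftrightarrow> (\<lambda>z. (z - p) * H z) \<midarrow>p\<rightarrow> 0"
proof -
  have "(\<lambda>z. (z - (p + l)) * H z) \<midarrow>p + l\<rightarrow> 0 \<longleftrightarrow> (\<lambda>z. (z - p) * H (z + l)) \<midarrow>p\<rightarrow> 0"
    using LIM_offset[of "\<lambda>z. (z - (p + l)) * H z" 0 "p + l" l]
      LIM_offset[of "\<lambda>z. (z - p) * H (z + l)" 0 p "- l"] by (auto simp: algebra_simps)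
  also have "\<dots> \<longleftrightarrow> (\<lambda>z. s * ((z - p) * H z)) \<midarrow>p\<rightarrow> 0"
    by (rule tendsto_cong[OF eventually_mono[OF assms(1)]]) simp
  also have "\<dots> \<longleftrightarrow> (\<lambda>z. (z - p) * H z) \<midarrow>p\<rightarrow> 0"
    using tendsto_mult_left_iff[OF assms(2), of "\<lambda>z. (z - p) * H z" 0] by simp
  finally show ?thesis .
qed

context sign_elliptic
begin

lemma open_Compl_lattice: "open (- period_lattice t)"
  using closed_period_lattice[OF Im_t] by (simp add: open_Compl)

lemma has_field_derivative_f: "z \<notin> period_lattice t \<Longrightarrow> (f has_field_derivative deriv f z) (at z)"
  using holomorphic_derivI[OF holomorphic_f open_Compl_lattice, of z UNIV] by simp

lemma isCont_f: "z \<notin> period_lattice t \<Longrightarrow> isCont f z"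
  using has_field_derivative_f DERIV_isCont by blast

lemma deriv_holomorphic: "deriv f holomorphic_on - period_lattice t"
  by (intro holomorphic_deriv holomorphic_f open_Compl_lattice)

lemma isCont_deriv: "z \<notin> period_lattice t \<Longrightarrow> isCont (deriv f) z"
  using deriv_holomorphic open_Compl_lattice
  by (metis ComplI continuous_on_eq_continuous_at holomorphic_on_imp_continuous_on)

lemma deriv_shift:
  assumes "\<And>z. f (z + l) = s * f z" "l \<in> period_lattice t" "z \<notin> period_lattice t"
  shows "deriv f (z + l) = s * deriv f z"
proof -
  have "z + l \<notin> period_lattice t" using assms(2,3) by (simp add: period_lattice_add_iff)
  from has_field_derivative_f[OF this] have "((\<lambda>z. f (z + l)) has_field_derivative deriv f (z + l)) (at z)"
    by (simp add: DERIV_shift)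
  moreover have "((\<lambda>z. s * f z) has_field_derivative s * deriv f z) (at z)"
    by (rule DERIV_cmult[OF has_field_derivative_f[OF assms(3)]])
  ultimately show ?thesis unfolding assms(1) by (rule DERIV_unique)
qed

theorem partial_fraction_expansion:
  fixes F :: "complex \<Rightarrow> complex" and pt :: "'k \<Rightarrow> complex" and c :: "'k \<Rightarrow> complex"
    and X :: "'k set"
  defines "P \<equiv> {z. \<exists>p\<in>insert 0 (pt ` X). z - p \<in> period_lattice t}"
  assumes sgn: "odd i \<or> odd j" and X: "finite X"
    and pt_notin: "\<And>x. x \<in> X \<Longrightarrow> pt x \<notin> period_lattice t"
    and pt_inj: "\<And>x y. x \<in> X \<Longrightarrow> y \<in> X \<Longrightarrow> pt x - pt y \<in> period_lattice t \<Longrightarrow> x = y"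
    and F: "F holomorphic_on - P"
    and F1: "\<And>z. F (z + 1) = (-1) ^ j * F z" and Ft: "\<And>z. F (z + t) = (-1) ^ i * F z"
    and simple: "\<And>x. x \<in> X \<Longrightarrow> (\<lambda>z. (z - pt x) * F z) \<midarrow>pt x\<rightarrow> c x"
    and double: "(\<lambda>z. z * (F z + d * deriv f z)) \<midarrow>0\<rightarrow> 0"
    and z: "z \<notin> P"
  shows "F z = (\<Sum>x\<in>X. c x * f (z - pt x)) - d * deriv f z"
proof -
  define H where "H = (\<lambda>z. F z + d * deriv f z - (\<Sum>x\<in>X. c x * f (z - pt x)))"
  have P_conv: "P = (\<Union>p\<in>insert 0 (pt ` X). (\<lambda>z. z - p) -` period_lattice t)"
    by (auto simp: P_def)
  have closedP: "closed P" unfolding P_conv using X closed_period_lattice[OF Im_t]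
    by (intro closed_UN ballI continuous_closed_vimage) (auto intro!: continuous_intros)
  have evP: "eventually (\<lambda>z. z \<notin> P) (at q)" for q
  proof -
    have "eventually (\<lambda>z. \<forall>p\<in>insert 0 (pt ` X). z - p \<notin> period_lattice t) (at q)"
      using X eventually_notin_period_lattice[OF Im_t] by (intro eventually_ball_finite) auto
    then show ?thesis by (simp add: P_def)
  qed
  have notP: "z \<notin> period_lattice t" "\<And>x. x \<in> X \<Longrightarrow> z - pt x \<notin> period_lattice t" if "z \<notin> P" for z
    using that by (auto simp: P_def)
  have P_shift: "z + l \<in> P \<longleftrightarrow> z \<in> P" if "l \<in> period_lattice t" for z l
  proof -
    have "z + l - p \<in> period_lattice t \<longleftrightarrow> z - p \<in> period_lattice t" for p
      using period_lattice_add_iff[OF that, of "z - p"] by (simp add: algebra_simps)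
    then show ?thesis by (simp only: P_def mem_Collect_eq)
  qed
  have "H holomorphic_on - P" unfolding H_def
  proof (intro holomorphic_on_diff holomorphic_on_add holomorphic_on_mult holomorphic_on_const holomorphic_on_sum F)
    show "deriv f holomorphic_on - P" by (rule holomorphic_on_subset[OF deriv_holomorphic]) (use notP in auto)
    fix x assume "x \<in> X"
    have "(\<lambda>z. z - pt x) holomorphic_on - P" by (intro holomorphic_intros)
    from holomorphic_on_compose_gen[OF this holomorphic_f] notP(2)[OF _ \<open>x \<in> X\<close>]
    show "(\<lambda>z. f (z - pt x)) holomorphic_on - P" by (auto simp: o_def)
  qed
  have H_shift: "H (z + l) = s * H z"
    if "z \<notin> P" "l \<in> period_lattice t" "\<And>z. F (z + l) = s * F z" "\<And>z. f (z + l) = s * f z" for z l s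
  proof -
    have "f (z + l - pt x) = s * f (z - pt x)" for x
      using that(4)[of "z - pt x"] by (simp add: algebra_simps)
    then show ?thesis
      unfolding H_def that(3) deriv_shift[OF that(4,2) notP(1)[OF that(1)]]
      by (simp add: sum_distrib_left algebra_simps)
  qed
  \<comment> \<open>\<open>Q p\<close> says that the singularity of H at p is removable. It is
    verified at 0 and at each \<open>pt x\<close>, then carried to the rest of P by the two
    periods.\<close>
  define Q where "Q = (\<lambda>p. (\<lambda>z. (z - p) * H z) \<midarrow>p\<rightarrow> 0)"
  have Q1: "Q (p + 1) = Q p" for p unfolding Q_def
    by (rule tendsto_pole_shift[where s = "(-1) ^ j"], rule eventually_mono[OF evP])
       (use H_shift[OF _ period_lattice_basics(2) F1 plus_1] in auto)
  have Qt: "Q (p + t) = Q p" for p unfolding Q_def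
    by (rule tendsto_pole_shift[where s = "(-1) ^ i"], rule eventually_mono[OF evP])
       (use H_shift[OF _ period_lattice_basics(3) Ft plus_tau] in auto)
  have f_term: "(\<lambda>z. (z - p) * (c x * f (z - q))) \<midarrow>p\<rightarrow> 0" if "p - q \<notin> period_lattice t" for p q x
  proof -
    have "isCont (\<lambda>z. f (z - q)) p"
      using LIM_offset[OF isContD[OF isCont_f[OF that]], of "- q"] by (simp add: isCont_def)
    then have "(\<lambda>z. (z - p) * (c x * f (z - q))) \<midarrow>p\<rightarrow> (p - p) * (c x * f (p - q))"
      by (intro tendsto_intros) (auto simp: isCont_def)
    then show ?thesis by simp
  qed
  have Q0: "Q 0"
  proof -
    have "(\<lambda>z. z * (F z + d * deriv f z) - (\<Sum>x\<in>X. (z - 0) * (c x * f (z - pt x)))) \<midarrow>0\<rightarrow> 0 - (\<Sum>x\<in>X. 0)"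
      using pt_notin
      by (intro tendsto_diff double tendsto_sum f_term) (metis diff_0 minus_minus period_lattice_minus)
    then show ?thesis by (simp add: Q_def H_def algebra_simps sum_distrib_left)
  qed
  have Qx: "Q (pt x)" if x: "x \<in> X" for x
  proof -
    have "(\<lambda>z. (z - pt x) * (c y * f (z - pt y))) \<midarrow>pt x\<rightarrow> (if x = y then c y else 0)" if y: "y \<in> X" for y
    proof (cases "x = y")
      case True
      have "(\<lambda>z. (z - pt x) * f (z - pt x)) \<midarrow>pt x\<rightarrow> 1"
        using LIM_offset[OF residue_0, of "- pt x"] by simp
      then have "(\<lambda>z. c x * ((z - pt x) * f (z - pt x))) \<midarrow>pt x\<rightarrow> c x * 1" by (intro tendsto_intros)
      then show ?thesis using True by (simp add: mult_ac)
    next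
      case False
      then have "pt x - pt y \<notin> period_lattice t" using pt_inj x y by blast
      then show ?thesis using False f_term by simp
    qed
    \<comment> \<open>Only the translate centred at \<open>pt x\<close> has a pole there and cancels
      \<open>c x\<close>; \<open>deriv f\<close> and the other translates are continuous at that
      point and are killed by the factor \<open>z - pt x\<close>.\<close>
    then have "(\<lambda>z. (z - pt x) * F z + d * ((z - pt x) * deriv f z) - (\<Sum>y\<in>X. (z - pt x) * (c y * f (z - pt y))))
        \<midarrow>pt x\<rightarrow> c x + d * ((pt x - pt x) * deriv f (pt x)) - (\<Sum>y\<in>X. if x = y then c y else 0)"
      using isCont_deriv[OF pt_notin[OF x]]
      by (intro tendsto_intros simple x) (auto simp: isCont_def)
    then show ?thesis using X x by (simp add: Q_def H_def algebra_simps sum_distrib_left)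
  qed
  have Q: "Q p" if pP: "p \<in> P" for p
  proof -
    obtain p0 where p0: "p0 \<in> insert 0 (pt ` X)" "p - p0 \<in> period_lattice t"
      using pP unfolding P_def mem_Collect_eq by blast
    then obtain m n where "p - p0 = of_int m * t + of_int n" by (auto simp: period_lattice_def)
    then have p: "p = p0 + of_int m * t + of_int n * 1" by (simp add: algebra_simps)
    have "Q p = Q p0" unfolding p
      using invariant_int_multiple[of Q 1, OF Q1] invariant_int_multiple[of Q t, OF Qt] by simp
    then show ?thesis using p0 Q0 Qx by auto
  qed
  obtain G where G: "G holomorphic_on UNIV" "\<And>z. z \<notin> P \<Longrightarrow> G z = H z"
    using removable_discrete_extension[OF closedP evP \<open>H holomorphic_on - P\<close>] Q unfolding Q_def by blast
  \<comment> \<open>The multiplier relation is inherited from H off P and extends to P by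
    continuity.\<close>
  have G_shift: "G (z + l) = s * G z"
    if "l \<in> period_lattice t" "\<And>z. F (z + l) = s * F z" "\<And>z. f (z + l) = s * f z" for z l s
  proof -
    have "isCont G w" for w
      using G(1) by (auto dest!: holomorphic_on_imp_continuous_on simp: continuous_on_eq_continuous_at)
    then have "isCont (\<lambda>z. G (z + l)) z" "isCont G z"
      using LIM_offset[of G "G (z + l)" "z + l" l] by (auto simp: isCont_def)
    then have "(\<lambda>z. G (z + l) - s * G z) \<midarrow>z\<rightarrow> G (z + l) - s * G z"
      by (intro tendsto_intros) (auto simp: isCont_def)
    moreover have "eventually (\<lambda>z. G (z + l) - s * G z = 0) (at z)"
      using evP by eventually_elim (use G(2) P_shift H_shift that in auto)
    then have "(\<lambda>z. G (z + l) - s * G z) \<midarrow>z\<rightarrow> 0" by (rule tendsto_eventually)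
    ultimately have "G (z + l) - s * G z = 0" using LIM_unique by blast
    then show ?thesis by simp
  qed
  have "G z = 0"
    by (rule entire_sign_periodic_eq_0[OF Im_t G(1) _ _ sgn])
       (intro G_shift period_lattice_basics F1 Ft plus_1 plus_tau)+
  then show ?thesis using G(2)[OF z] by (simp add: H_def algebra_simps)
qed

end

section \<open>Expansion at the origin\<close>

text \<open>With the residue 1 filled in at 0, z f(z) is given by an ordinary power series in which
  C(s) is the coefficient of z^(2s); Laurent series can then be avoided when coefficients are
  compared.\<close>

definition pole_cleared :: "(complex \<Rightarrow> complex) \<Rightarrow> complex \<Rightarrow> complex" where
  "pole_cleared f z = (if z = 0 then 1 else z * f z)"

lemma has_fps_expansion_scale:
  fixes f :: "complex \<Rightarrow> complex"
  assumes "f has_fps_expansion F"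
  shows "(\<lambda>z. f (c * z)) has_fps_expansion Abs_fps (\<lambda>n. c ^ n * fps_nth F n)"
proof -
  have "(\<lambda>z. c * z) has_fps_expansion fps_const c * fps_X" by (intro fps_expansion_intros)
  from has_fps_expansion_compose[OF assms this]
  have "(\<lambda>z. f (c * z)) has_fps_expansion fps_compose F (fps_const c * fps_X)" by (simp add: o_def)
  also have "fps_compose F (fps_const c * fps_X) = Abs_fps (\<lambda>n. c ^ n * fps_nth F n)"
  proof (rule fps_ext)
    fix n
    have "fps_nth ((fps_const c * fps_X) ^ k) n = (if n = k then c ^ k else 0)" for k
      by (simp add: power_mult_distrib fps_const_power)
    then show "fps_nth (fps_compose F (fps_const c * fps_X)) n = fps_nth (Abs_fps (\<lambda>n. c ^ n * fps_nth F n)) n"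
      by (simp add: fps_compose_nth mult_delta_right mult.commute)
  qed
  finally show ?thesis .
qed

context sign_elliptic
begin

lemma pole_cleared_minus: "pole_cleared f (- z) = pole_cleared f z"
  by (simp add: pole_cleared_def odd_fun)

lemma pole_cleared_analytic: "pole_cleared f analytic_on {0}"
proof -
  obtain S where S: "open S" "0 \<in> S" "\<And>z. z \<in> S \<Longrightarrow> z \<noteq> 0 \<Longrightarrow> z \<notin> period_lattice t"
    using eventually_notin_period_lattice[OF Im_t, of 0 0] unfolding eventually_at_topological by auto
  have "(\<lambda>z. z * f z) holomorphic_on S - {0}"
    by (intro holomorphic_intros holomorphic_on_subset[OF holomorphic_f]) (use S in auto)
  from removable_singularity[OF this S(1) residue_0]
  have "pole_cleared f holomorphic_on S" unfolding pole_cleared_def .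
  then show ?thesis using S by (auto simp: analytic_at)
qed

lemma pole_cleared_fps: "pole_cleared f has_fps_expansion fps_expansion (pole_cleared f) 0"
  by (rule analytic_at_imp_has_fps_expansion_0[OF pole_cleared_analytic])

lemma pole_cleared_fps_odd:
  assumes "odd n"
  shows "fps_nth (fps_expansion (pole_cleared f) 0) n = 0"
proof -
  let ?U = "fps_expansion (pole_cleared f) 0"
  have "(\<lambda>z. pole_cleared f (-1 * z)) has_fps_expansion Abs_fps (\<lambda>n. (-1) ^ n * fps_nth ?U n)"
    by (rule has_fps_expansion_scale[OF pole_cleared_fps])
  then have "pole_cleared f has_fps_expansion Abs_fps (\<lambda>n. (-1) ^ n * fps_nth ?U n)"
    by (simp add: pole_cleared_minus)
  from fps_expansion_unique_complex[OF this pole_cleared_fps]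
  have "fps_nth (Abs_fps (\<lambda>n. (-1) ^ n * fps_nth ?U n)) n = fps_nth ?U n" by simp
  then show ?thesis using assms by simp
qed

lemma laurent_coefficient_conv_fps:
  "fls_nth (laurent_expansion f 0) (2 * int s - 1) = fps_nth (fps_expansion (pole_cleared f) 0) (2 * s)"
proof -
  let ?U = "fps_expansion (pole_cleared f) 0"
  have "(\<lambda>z. inverse z * pole_cleared f z) has_laurent_expansion fls_X_inv * fps_to_fls ?U"
    by (intro laurent_expansion_intros has_laurent_expansion_fps pole_cleared_fps)
  moreover have "eventually (\<lambda>z. inverse z * pole_cleared f z = f z) (at 0)"
    by (auto simp: eventually_at_filter pole_cleared_def)
  ultimately have "f has_laurent_expansion fls_X_inv * fps_to_fls ?U"
    by (simp only: has_laurent_expansion_cong[OF _ refl])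
  then show ?thesis
    by (simp add: laurent_expansion_0_eqI fls_X_inv_times_conv_shift nat_mult_distrib)
qed

text \<open>With u(z) = z f(z) one has u' = f + z f'. The identity trades the double pole of f' for
  terms holomorphic at 0.\<close>

lemma pole_cleared_deriv:
  assumes "z \<noteq> 0" "z \<notin> period_lattice t"
  shows "z\<^sup>2 * deriv f z = z * deriv (pole_cleared f) z - pole_cleared f z"
proof -
  have "((\<lambda>z. z * f z) has_field_derivative 1 * f z + deriv f z * z) (at z)"
    by (rule DERIV_mult[OF DERIV_ident has_field_derivative_f[OF assms(2)]])
  moreover have "eventually (\<lambda>w. w * f w = pole_cleared f w) (nhds z)"
    using eventually_nhds_in_open[of "- {0}" z] assms(1) by (auto simp: pole_cleared_def elim!: eventually_mono)
  ultimately have "(pole_cleared f has_field_derivative f z + deriv f z * z) (at z)"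
    using DERIV_cong_ev[OF refl _ refl] by fastforce
  then have "deriv (pole_cleared f) z = f z + deriv f z * z" by (rule DERIV_imp_deriv)
  then show ?thesis using assms(1) by (simp add: pole_cleared_def power2_eq_square algebra_simps)
qed

lemma deriv_pole_cleared_0: "deriv (pole_cleared f) 0 = 0"
  using pole_cleared_fps_odd[of 1] fps_nth_fps_expansion[OF pole_cleared_fps, of 1] by simp

lemma f_shift: "f (z + of_nat \<mu> * t + of_nat \<nu>) = (-1) ^ (i * \<mu> + j * \<nu>) * f z"
proof -
  have 1: "f (z + of_nat \<nu>) = (-1) ^ (j * \<nu>) * f z" for z \<nu>
  proof (induction \<nu>)
    case (Suc \<nu>)
    have "f (z + of_nat (Suc \<nu>)) = f ((z + of_nat \<nu>) + 1)" by (simp add: add_ac)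
    also have "\<dots> = (-1) ^ j * ((-1) ^ (j * \<nu>) * f z)" by (simp only: plus_1 Suc)
    finally show ?case by (simp add: power_add)
  qed simp
  have 2: "f (z + of_nat \<mu> * t) = (-1) ^ (i * \<mu>) * f z" for z \<mu>
  proof (induction \<mu>)
    case (Suc \<mu>)
    have "f (z + of_nat (Suc \<mu>) * t) = f ((z + of_nat \<mu> * t) + t)" by (simp add: algebra_simps)
    also have "\<dots> = (-1) ^ i * ((-1) ^ (i * \<mu>) * f z)" by (simp only: plus_tau Suc)
    finally show ?case by (simp add: power_add)
  qed simp
  show ?thesis by (simp add: 1 2 power_add)
qed

text \<open>Since a p is a lattice point, f(az) is a sign times f(a(z - p)), whose residue at p is
  1/a.\<close>

lemma tendsto_scaled_pole:
  assumes a: "a \<noteq> 0" and p: "a * p = of_nat \<mu> * t + of_nat \<nu>"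
  shows "(\<lambda>z. (z - p) * f (a * z)) \<midarrow>p\<rightarrow> (-1) ^ (i * \<mu> + j * \<nu>) / a"
proof -
  have "filterlim (\<lambda>z. a * (z - p)) (at 0) (at p)"
    unfolding filterlim_at using a
    by (auto simp: eventually_at_filter intro!: tendsto_eq_intros)
  from filterlim_compose[OF residue_0 this]
  have "(\<lambda>z. (-1) ^ (i * \<mu> + j * \<nu>) / a * (a * (z - p) * f (a * (z - p)))) \<midarrow>p\<rightarrow> (-1) ^ (i * \<mu> + j * \<nu>) / a * 1"
    by (intro tendsto_intros)
  moreover have "(-1) ^ (i * \<mu> + j * \<nu>) / a * (a * (z - p) * f (a * (z - p))) = (z - p) * f (a * z)" for z
  proof -
    have "a * z = a * (z - p) + of_nat \<mu> * t + of_nat \<nu>" using p by (simp add: algebra_simps)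
    then have "f (a * z) = (-1) ^ (i * \<mu> + j * \<nu>) * f (a * (z - p))" by (simp only: f_shift)
    then show ?thesis using a by simp
  qed
  ultimately show ?thesis by simp
qed

text \<open>The reflected form h(p - z) = - h(z - p) is expanded so that the derivatives are taken
  at p and not at -p; in even degree the factor (-1)^n disappears.\<close>

lemma reflected_has_fps_expansion:
  assumes p: "p \<notin> period_lattice t"
  shows "(\<lambda>z. f (p - z)) has_fps_expansion Abs_fps (\<lambda>n. (-1) ^ n * (deriv ^^ n) f p / fact n)"
proof -
  define S where "S = (\<lambda>z. p - z) -` (- period_lattice t)"
  have S: "open S" "0 \<in> S" unfolding S_def using p open_Compl_lattice
    by (auto intro!: open_vimage continuous_intros)
  have h: "(deriv ^^ n) (\<lambda>w. f (-1 * w + p)) 0 = (-1) ^ n * (deriv ^^ n) f (-1 * 0 + p)" for n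
    by (rule higher_deriv_compose_linear'[OF holomorphic_f S(1) open_Compl_lattice S(2)]) (simp add: S_def)
  have "(\<lambda>z. p - z) holomorphic_on S" by (intro holomorphic_intros)
  from holomorphic_on_compose_gen[OF this holomorphic_f]
  have "(\<lambda>z. f (p - z)) holomorphic_on S" by (auto simp: o_def S_def)
  then have "(\<lambda>z. f (p - z)) analytic_on {0}" using S by (auto simp: analytic_at)
  then have *: "(\<lambda>z. f (p - z)) has_fps_expansion fps_expansion (\<lambda>z. f (p - z)) 0"
    by (rule analytic_at_imp_has_fps_expansion_0)
  also have "fps_expansion (\<lambda>z. f (p - z)) 0 = Abs_fps (\<lambda>n. (-1) ^ n * (deriv ^^ n) f p / fact n)"
    by (rule fps_ext) (use fps_nth_fps_expansion[OF *] h in simp)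
  finally show ?thesis .
qed

end

text \<open>With u, v, w the functions f, g, h cleared of their poles, the expression equals (Q(z)/z
  + w'(z))/(ab) for Q(z) = u(az) v(bz) - w(z). All three are even with value 1 at 0, so Q, Q' and w'
  vanish there.\<close>

lemma tendsto_double_pole:
  assumes f: "sign_elliptic t i j f" and g: "sign_elliptic t m n g" and h: "sign_elliptic t k l h"
    and ab: "a \<noteq> 0" "b \<noteq> 0"
  shows "(\<lambda>z. z * (f (a * z) * g (b * z) + 1 / (a * b) * deriv h z)) \<midarrow>0\<rightarrow> 0"
proof -
  interpret f: sign_elliptic t i j f by fact
  interpret g: sign_elliptic t m n g by fact
  interpret h: sign_elliptic t k l h by fact
  let ?f = "pole_cleared f" and ?g = "pole_cleared g" and ?h = "pole_cleared h"
  define Q where "Q = (\<lambda>z. ?f (a * z) * ?g (b * z) - ?h z)"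
  have d: "(pole_cleared F has_field_derivative 0) (at 0)" if "sign_elliptic t i' j' F" for i' j' F
    using sign_elliptic.deriv_pole_cleared_0[OF that] sign_elliptic.pole_cleared_analytic[OF that]
    by (metis DERIV_deriv_iff_field_differentiable analytic_on_imp_differentiable_at insertI1)
  have d': "((\<lambda>z. pole_cleared F (c * z)) has_field_derivative 0) (at 0)" if "sign_elliptic t i' j' F" for i' j' F c
    using DERIV_chain2[of "pole_cleared F" 0 "\<lambda>z. c * z" 0 c UNIV] d[OF that]
    by (auto intro!: derivative_eq_intros)
  have "(Q has_field_derivative 0 * ?g (b * 0) + 0 * ?f (a * 0) - 0) (at 0)"
    unfolding Q_def by (intro DERIV_diff DERIV_mult d'[OF f] d'[OF g] d[OF h])
  moreover have "Q 0 = 0" by (simp add: Q_def pole_cleared_def)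
  ultimately have Q: "(\<lambda>z. Q z / z) \<midarrow>0\<rightarrow> 0" by (simp add: DERIV_def)
  have "deriv ?h analytic_on {0}" by (intro analytic_deriv h.pole_cleared_analytic)
  then have "deriv ?h \<midarrow>0\<rightarrow> 0"
    using h.deriv_pole_cleared_0 analytic_at_imp_isCont[of "deriv ?h" 0] by (simp add: isCont_def)
  with Q have "(\<lambda>z. 1 / (a * b) * (Q z / z + deriv ?h z)) \<midarrow>0\<rightarrow> 1 / (a * b) * (0 + 0)"
    by (intro tendsto_intros)
  moreover have "eventually (\<lambda>z. 1 / (a * b) * (Q z / z + deriv ?h z) =
      z * (f (a * z) * g (b * z) + 1 / (a * b) * deriv h z)) (at 0)"
    using eventually_notin_period_lattice[OF f.Im_t, of 0 0] eventually_neq_at_within[of 0 0 UNIV]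
  proof eventually_elim
    case (elim z)
    have "z * (z * (f (a * z) * g (b * z) + 1 / (a * b) * deriv h z)) =
        1 / (a * b) * (?f (a * z) * ?g (b * z)) + 1 / (a * b) * (z\<^sup>2 * deriv h z)"
      using elim ab by (simp add: pole_cleared_def field_simps power2_eq_square)
    also have "\<dots> = z * (1 / (a * b) * (Q z / z + deriv ?h z))"
      using elim ab by (subst h.pole_cleared_deriv) (simp_all add: Q_def field_simps)
    finally show ?case using elim by (simp only: mult_cancel_left) auto
  qed
  ultimately show ?thesis using tendsto_cong by fastforce
qed

section \<open>Division points of the lattice\<close>

text \<open>Im t > 0 makes t and 1 linearly independent over the reals: comparing imaginary parts
  fixes the coefficient of t, and real parts then fix the other.\<close>

lemma divided_lattice_point_iff:
  assumes t: "Im t > 0" and a: "a > 0"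
  shows "(of_int m * t + of_int n) / of_int a \<in> period_lattice t \<longleftrightarrow> a dvd m \<and> a dvd n"
proof
  assume "(of_int m * t + of_int n) / of_int a \<in> period_lattice t"
  then obtain m' n' where "(of_int m * t + of_int n) / of_int a = of_int m' * t + of_int n'"
    by (auto simp: period_lattice_def)
  then have eq: "of_int m * t + of_int n = of_int (a * m') * t + of_int (a * n')"
    using a by (simp add: field_simps)
  have "of_int m * Im t = of_int (a * m') * Im t" using arg_cong[OF eq, of Im] by simp
  then have m: "m = a * m'" using t by (simp del: of_int_mult)
  then have "n = a * n'" using arg_cong[OF eq, of Re] by (simp del: of_int_mult)
  with m show "a dvd m \<and> a dvd n" by simp
next
  assume "a dvd m \<and> a dvd n"
  then obtain m' n' where "m = a * m'" "n = a * n'" by (auto elim!: dvdE)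
  then have "(of_int m * t + of_int n) / of_int a = of_int m' * t + of_int n'"
    using a by (simp add: add_divide_distrib)
  then show "(of_int m * t + of_int n) / of_int a \<in> period_lattice t" by (simp add: period_lattice_int)
qed

definition division_point :: "complex \<Rightarrow> nat \<Rightarrow> nat \<times> nat \<Rightarrow> complex" where
  "division_point t a = (\<lambda>(\<mu>, \<nu>). (of_nat \<mu> * t + of_nat \<nu>) / of_nat a)"

definition proper_indices :: "nat \<Rightarrow> (nat \<times> nat) set" where
  "proper_indices a = {0..<a} \<times> {0..<a} - {(0, 0)}"

lemma int_dvd_diff_small:
  assumes "int a dvd int k - int l" "k < a" "l < a"
  shows "k = l"
  using assms by (metis mod_eq_dvd_iff mod_less of_nat_mod of_nat_eq_iff)

lemma division_point_inj:
  assumes t: "Im t > 0" and p: "p \<in> proper_indices a" and q: "q \<in> proper_indices a"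
    and "division_point t a p - division_point t a q \<in> period_lattice t"
  shows "p = q"
proof -
  obtain \<mu> \<nu> \<mu>' \<nu>' where pq: "p = (\<mu>, \<nu>)" "q = (\<mu>', \<nu>')" by (metis surj_pair)
  have less: "\<mu> < a" "\<nu> < a" "\<mu>' < a" "\<nu>' < a" using p q by (auto simp: pq proper_indices_def)
  have "division_point t a p - division_point t a q =
      (of_int (int \<mu> - int \<mu>') * t + of_int (int \<nu> - int \<nu>')) / of_int (int a)"
    by (simp add: division_point_def pq diff_divide_distrib algebra_simps add_divide_distrib)
  with assms(4) have "(of_int (int \<mu> - int \<mu>') * t + of_int (int \<nu> - int \<nu>')) / of_int (int a) \<in> period_lattice t"
    by (simp only:)
  moreover have "int a > 0" using less by simp
  ultimately have "int a dvd int \<mu> - int \<mu>'" "int a dvd int \<nu> - int \<nu>'"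
    by (simp_all only: divided_lattice_point_iff[OF t])
  then show ?thesis using int_dvd_diff_small less by (auto simp: pq)
qed

text \<open>By coprimality a would divide both mu and nu, which are below a and not both 0. Hence
  g(bz) is regular at the a-division points and the poles of f(az) there stay simple in the
  product.\<close>

lemma multiple_division_point_notin:
  assumes t: "Im t > 0" and "coprime a b" and p: "p \<in> proper_indices a"
  shows "of_nat b * division_point t a p \<notin> period_lattice t"
proof
  assume mem: "of_nat b * division_point t a p \<in> period_lattice t"
  obtain \<mu> \<nu> where [simp]: "p = (\<mu>, \<nu>)" by (metis surj_pair)
  have less: "\<mu> < a" "\<nu> < a" "(\<mu>, \<nu>) \<noteq> (0, 0)" using p by (auto simp: proper_indices_def)
  have "of_nat b * division_point t a p = (of_int (int (b * \<mu>)) * t + of_int (int (b * \<nu>))) / of_int (int a)"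
    by (simp add: division_point_def algebra_simps)
  with mem have "(of_int (int (b * \<mu>)) * t + of_int (int (b * \<nu>))) / of_int (int a) \<in> period_lattice t"
    by (simp only:)
  moreover have "int a > 0" using less by simp
  ultimately have "int a dvd int (b * \<mu>)" "int a dvd int (b * \<nu>)"
    by (simp_all only: divided_lattice_point_iff[OF t])
  then have "a dvd b * \<mu>" "a dvd b * \<nu>" by (simp_all only: int_dvd_int_iff)
  then have "a dvd \<mu>" "a dvd \<nu>" using assms(2) by (auto simp: coprime_dvd_mult_right_iff)
  then show False using less by (auto dest: dvd_imp_le)
qed

lemma division_point_notin:
  assumes "Im t > 0" "p \<in> proper_indices a"
  shows "division_point t a p \<notin> period_lattice t"
  using multiple_division_point_notin[OF assms(1) _ assms(2), of 1] by simp

text \<open>Multiplication by b sends the b-division point into the lattice, so the a-division point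
  would contradict \<open>multiple_division_point_notin\<close>.\<close>

lemma division_point_mixed:
  assumes t: "Im t > 0" and "coprime a b" and b: "b > 0" and p: "p \<in> proper_indices a"
  shows "division_point t a p - division_point t b q \<notin> period_lattice t"
proof
  assume mem: "division_point t a p - division_point t b q \<in> period_lattice t"
  obtain \<mu> \<nu> where q: "q = (\<mu>, \<nu>)" by (metis surj_pair)
  obtain m n where "division_point t a p - division_point t b q = of_int m * t + of_int n"
    using mem by (auto simp: period_lattice_def)
  then have "division_point t a p = division_point t b q + of_int m * t + of_int n"
    by (simp add: algebra_simps)
  then have "of_nat b * division_point t a p = of_nat b * division_point t b q + of_nat b * (of_int m * t + of_int n)"
    by (simp add: algebra_simps)
  also have "of_nat b * division_point t b q = of_nat \<mu> * t + of_nat \<nu>"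
    using b by (simp add: division_point_def q)
  also have "of_nat \<mu> * t + of_nat \<nu> + of_nat b * (of_int m * t + of_int n) =
      of_int (int \<mu> + int b * m) * t + of_int (int \<nu> + int b * n)"
    by (simp add: algebra_simps)
  finally have "of_nat b * division_point t a p \<in> period_lattice t" by (simp only: period_lattice_int)
  then show False using multiple_division_point_notin[OF t assms(2) p] by simp
qed

text \<open>Reducing both lattice coordinates of \<open>of_nat a * z\<close> modulo a gives the
  representative; every pole of f(az) is thus accounted for.\<close>

lemma multiple_in_lattice_cases:
  assumes a: "a > 0" and "of_nat a * z \<in> period_lattice t"
  shows "\<exists>p\<in>insert 0 (division_point t a ` proper_indices a). z - p \<in> period_lattice t"
proof -
  obtain m n where mn: "of_nat a * z = of_int m * t + of_int n"
    using assms(2) by (auto simp: period_lattice_def)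
  define \<mu> \<nu> where "\<mu> = nat (m mod int a)" and "\<nu> = nat (n mod int a)"
  have mod: "int \<mu> = m mod int a" "int \<nu> = n mod int a" using a by (auto simp: \<mu>_def \<nu>_def)
  have "of_nat a * division_point t a (\<mu>, \<nu>) = of_nat \<mu> * t + of_nat \<nu>"
    using a by (simp add: division_point_def)
  then have "of_nat a * (z - division_point t a (\<mu>, \<nu>)) = of_int (m - int \<mu>) * t + of_int (n - int \<nu>)"
    using mn by (simp add: algebra_simps)
  also have "m - int \<mu> = int a * (m div int a)" unfolding mod by (simp add: minus_mod_eq_mult_div)
  also have "n - int \<nu> = int a * (n div int a)" unfolding mod by (simp add: minus_mod_eq_mult_div)
  also have "of_int (int a * (m div int a)) * t + of_int (int a * (n div int a)) =
      of_nat a * (of_int (m div int a) * t + of_int (n div int a))" by (simp add: algebra_simps)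
  finally have "z - division_point t a (\<mu>, \<nu>) = of_int (m div int a) * t + of_int (n div int a)"
    using a by simp
  then have mem: "z - division_point t a (\<mu>, \<nu>) \<in> period_lattice t" by (simp add: period_lattice_int)
  have less: "\<mu> < a" "\<nu> < a" using a by (auto simp: \<mu>_def \<nu>_def nat_less_iff)
  show ?thesis
  proof (cases "(\<mu>, \<nu>) = (0, 0)")
    case True
    then show ?thesis using mem by (simp add: division_point_def)
  next
    case False
    then have "(\<mu>, \<nu>) \<in> proper_indices a" using less by (auto simp: proper_indices_def)
    then show ?thesis using mem by blast
  qed
qed

section \<open>The partial fraction expansion of f(az) g(bz) and its coefficients\<close>

lemma sum_even_indices:
  fixes F :: "nat \<Rightarrow> 'a :: comm_monoid_add"
  assumes "\<And>k. odd k \<Longrightarrow> F k = 0"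
  shows "(\<Sum>k=0..2 * n. F k) = (\<Sum>s=0..n. F (2 * s))"
  using assms by (induction n) simp_all

lemma product_partial_fractions:
  assumes f: "sign_elliptic t i j f" and g: "sign_elliptic t m n g"
    and h: "sign_elliptic t (i * a + m * b) (j * a + n * b) h"
    and ab: "a > 0" "b > 0" "coprime a b" and sgn: "odd (i * a + m * b) \<or> odd (j * a + n * b)"
  shows "eventually (\<lambda>z. f (of_nat a * z) * g (of_nat b * z) =
    - (\<Sum>(\<mu>, \<nu>)\<in>proper_indices a. (-1) ^ (i * \<mu> + j * \<nu>) / of_nat a * g (of_nat b * division_point t a (\<mu>, \<nu>)) *
         h (division_point t a (\<mu>, \<nu>) - z))
    - (\<Sum>(\<mu>, \<nu>)\<in>proper_indices b. (-1) ^ (m * \<mu> + n * \<nu>) / of_nat b * f (of_nat a * division_point t b (\<mu>, \<nu>)) *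
         h (division_point t b (\<mu>, \<nu>) - z))
    - 1 / (of_nat a * of_nat b) * deriv h z) (at 0)"
proof -
  interpret f: sign_elliptic t i j f by fact
  interpret g: sign_elliptic t m n g by fact
  interpret h: sign_elliptic t "i * a + m * b" "j * a + n * b" h by fact
  note t = f.Im_t
  define pt where "pt = case_sum (division_point t a) (division_point t b)"
  \<comment> \<open>A disjoint sum, because the same pair (mu, nu) can index both an a-division and
    a b-division point.\<close>
  define X where "X = proper_indices a <+> proper_indices b"
  define F where "F = (\<lambda>z. f (of_nat a * z) * g (of_nat b * z))"
  define c where "c = case_sum (\<lambda>(\<mu>, \<nu>). (-1) ^ (i * \<mu> + j * \<nu>) / of_nat a * g (of_nat b * division_point t a (\<mu>, \<nu>)))
     (\<lambda>(\<mu>, \<nu>). (-1) ^ (m * \<mu> + n * \<nu>) / of_nat b * f (of_nat a * division_point t b (\<mu>, \<nu>)))"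
  define P where "P = {z. \<exists>p\<in>insert 0 (pt ` X). z - p \<in> period_lattice t}"
  have fin: "finite (proper_indices k)" for k by (simp add: proper_indices_def)
  have cop: "coprime b a" using ab by (simp add: coprime_commute)
  have notP: "of_nat a * z \<notin> period_lattice t" "of_nat b * z \<notin> period_lattice t" if "z \<notin> P" for z
  proof -
    have sub: "division_point t a ` proper_indices a \<subseteq> pt ` X" "division_point t b ` proper_indices b \<subseteq> pt ` X"
      by (force simp: pt_def X_def image_iff)+
    show "of_nat a * z \<notin> period_lattice t"
      using multiple_in_lattice_cases[OF ab(1), of z t] sub(1) that unfolding P_def by blast
    show "of_nat b * z \<notin> period_lattice t"
      using multiple_in_lattice_cases[OF ab(2), of z t] sub(2) that unfolding P_def by blast
  qed
  have expansion: "F z = (\<Sum>x\<in>X. c x * h (z - pt x)) - 1 / (of_nat a * of_nat b) * deriv h z" if "z \<notin> P" for z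
  proof (rule h.partial_fraction_expansion[OF sgn])
    show "finite X" using fin by (simp add: X_def)
    show "pt x \<notin> period_lattice t" if "x \<in> X" for x
      using that division_point_notin[OF t] by (auto simp: X_def pt_def)
    show "x = y" if "x \<in> X" "y \<in> X" "pt x - pt y \<in> period_lattice t" for x y
      using that division_point_inj[OF t] division_point_mixed[OF t ab(3,2)] division_point_mixed[OF t cop ab(1)]
      by (auto simp: X_def pt_def)
    show "F holomorphic_on - {z. \<exists>p\<in>insert 0 (pt ` X). z - p \<in> period_lattice t}"
    proof -
      have "(\<lambda>z. of_nat k * z) holomorphic_on - P" for k by (intro holomorphic_intros)
      from holomorphic_on_compose_gen[OF this f.holomorphic_f, of a] holomorphic_on_compose_gen[OF this g.holomorphic_f, of b]
      have "F holomorphic_on - P" unfolding F_def using notP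
        by (intro holomorphic_on_mult) (auto simp: o_def)
      then show ?thesis by (simp only: P_def)
    qed
    \<comment> \<open>Shifting z by 1 shifts the argument of f by a and that of g by b, so the signs
      multiply; this fixes the indices of h.\<close>
    show "F (z + 1) = (-1) ^ (j * a + n * b) * F z" for z
      using f.f_shift[of "of_nat a * z" 0 a] g.f_shift[of "of_nat b * z" 0 b]
      by (simp add: F_def algebra_simps power_add)
    show "F (z + t) = (-1) ^ (i * a + m * b) * F z" for z
      using f.f_shift[of "of_nat a * z" a 0] g.f_shift[of "of_nat b * z" b 0]
      by (simp add: F_def algebra_simps power_add)
    show "(\<lambda>z. z * (F z + 1 / (of_nat a * of_nat b) * deriv h z)) \<midarrow>0\<rightarrow> 0"
      unfolding F_def by (rule tendsto_double_pole[OF f g h]) (use ab in auto)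
    show "z \<notin> {z. \<exists>p\<in>insert 0 (pt ` X). z - p \<in> period_lattice t}" using that unfolding P_def by assumption
    fix x assume "x \<in> X"
    then consider \<mu> \<nu> where "x = Inl (\<mu>, \<nu>)" "(\<mu>, \<nu>) \<in> proper_indices a"
      | \<mu> \<nu> where "x = Inr (\<mu>, \<nu>)" "(\<mu>, \<nu>) \<in> proper_indices b" by (auto simp: X_def)
    then show "(\<lambda>z. (z - pt x) * F z) \<midarrow>pt x\<rightarrow> c x"
    proof cases
      case 1
      let ?p = "division_point t a (\<mu>, \<nu>)"
      have "(\<lambda>z. (z - ?p) * f (of_nat a * z)) \<midarrow>?p\<rightarrow> (-1) ^ (i * \<mu> + j * \<nu>) / of_nat a"
        using ab by (intro f.tendsto_scaled_pole) (auto simp: division_point_def)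
      moreover have "(\<lambda>z. g (of_nat b * z)) \<midarrow>?p\<rightarrow> g (of_nat b * ?p)"
        by (intro isCont_tendsto_compose[OF g.isCont_f] multiple_division_point_notin[OF t ab(3) 1(2)] tendsto_intros)
      ultimately have "(\<lambda>z. (z - ?p) * f (of_nat a * z) * g (of_nat b * z)) \<midarrow>?p\<rightarrow>
          (-1) ^ (i * \<mu> + j * \<nu>) / of_nat a * g (of_nat b * ?p)" by (rule tendsto_mult)
      then show ?thesis by (simp add: 1(1) pt_def c_def F_def mult.assoc)
    next
      case 2
      let ?p = "division_point t b (\<mu>, \<nu>)"
      have "(\<lambda>z. (z - ?p) * g (of_nat b * z)) \<midarrow>?p\<rightarrow> (-1) ^ (m * \<mu> + n * \<nu>) / of_nat b"
        using ab by (intro g.tendsto_scaled_pole) (auto simp: division_point_def)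
      moreover have "(\<lambda>z. f (of_nat a * z)) \<midarrow>?p\<rightarrow> f (of_nat a * ?p)"
        by (intro isCont_tendsto_compose[OF f.isCont_f] multiple_division_point_notin[OF t cop 2(2)] tendsto_intros)
      ultimately have "(\<lambda>z. (z - ?p) * g (of_nat b * z) * f (of_nat a * z)) \<midarrow>?p\<rightarrow>
          (-1) ^ (m * \<mu> + n * \<nu>) / of_nat b * f (of_nat a * ?p)" by (rule tendsto_mult)
      then show ?thesis by (simp add: 2(1) pt_def c_def F_def mult_ac)
    qed
  qed
  have "eventually (\<lambda>z. \<forall>p\<in>insert 0 (pt ` X). z - p \<notin> period_lattice t) (at 0)"
    using fin eventually_notin_period_lattice[OF t] by (intro eventually_ball_finite) (auto simp: X_def)
  then have "eventually (\<lambda>z. z \<notin> P) (at 0)" by (simp add: P_def)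
  then show ?thesis
  proof eventually_elim
    case (elim z)
    have reflect: "h (z - p) = - h (p - z)" for p using h.odd_fun[of "p - z"] by simp
    have "(\<Sum>x\<in>X. c x * h (z - pt x)) = - (\<Sum>x\<in>X. c x * h (pt x - z))"
      by (simp add: reflect sum_negf)
    also have "(\<Sum>x\<in>X. c x * h (pt x - z)) =
      (\<Sum>(\<mu>, \<nu>)\<in>proper_indices a. (-1) ^ (i * \<mu> + j * \<nu>) / of_nat a * g (of_nat b * division_point t a (\<mu>, \<nu>)) *
         h (division_point t a (\<mu>, \<nu>) - z)) +
      (\<Sum>(\<mu>, \<nu>)\<in>proper_indices b. (-1) ^ (m * \<mu> + n * \<nu>) / of_nat b * f (of_nat a * division_point t b (\<mu>, \<nu>)) *
         h (division_point t b (\<mu>, \<nu>) - z))"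
      unfolding X_def sum.Plus[OF fin fin] by (simp add: o_def c_def pt_def case_prod_unfold)
    finally show ?case using expansion[OF elim] by (simp add: F_def)
  qed
qed

theorem reciprocity_fps:
  assumes f: "sign_elliptic t i j f" and g: "sign_elliptic t m n g"
    and h: "sign_elliptic t (i * a + m * b) (j * a + n * b) h"
    and ab: "a > 0" "b > 0" "coprime a b" and sgn: "odd (i * a + m * b) \<or> odd (j * a + n * b)"
  defines "U \<equiv> fps_expansion (pole_cleared f) 0" and "V \<equiv> fps_expansion (pole_cleared g) 0"
    and "W \<equiv> fps_expansion (pole_cleared h) 0"
  shows "(\<Sum>s=0..N + 1. of_nat a ^ (2 * s) * fps_nth U (2 * s) *
            (of_nat b ^ (2 * (N + 1 - s)) * fps_nth V (2 * (N + 1 - s)))) =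
    - of_nat a * of_nat b *
       ((\<Sum>(\<mu>, \<nu>)\<in>proper_indices a. (-1) ^ (i * \<mu> + j * \<nu>) / of_nat a * g (of_nat b * division_point t a (\<mu>, \<nu>)) *
           ((deriv ^^ (2 * N)) h (division_point t a (\<mu>, \<nu>)) / fact (2 * N))) +
        (\<Sum>(\<mu>, \<nu>)\<in>proper_indices b. (-1) ^ (m * \<mu> + n * \<nu>) / of_nat b * f (of_nat a * division_point t b (\<mu>, \<nu>)) *
           ((deriv ^^ (2 * N)) h (division_point t b (\<mu>, \<nu>)) / fact (2 * N))))
    - of_nat (2 * N + 1) * fps_nth W (2 * (N + 1))"
proof -
  interpret f: sign_elliptic t i j f by fact
  interpret g: sign_elliptic t m n g by fact
  interpret h: sign_elliptic t "i * a + m * b" "j * a + n * b" h by fact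
  note t = f.Im_t
  let ?u = "pole_cleared f" and ?v = "pole_cleared g" and ?w = "pole_cleared h"
  let ?a = "of_nat a :: complex" and ?b = "of_nat b :: complex"
  define c1 where "c1 = (\<lambda>(\<mu>, \<nu>). (-1) ^ (i * \<mu> + j * \<nu>) / ?a * g (?b * division_point t a (\<mu>, \<nu>)))"
  define c2 where "c2 = (\<lambda>(\<mu>, \<nu>). (-1) ^ (m * \<mu> + n * \<nu>) / ?b * f (?a * division_point t b (\<mu>, \<nu>)))"
  define T where "T = (\<lambda>p. Abs_fps (\<lambda>n. (-1) ^ n * (deriv ^^ n) h p / fact n))"
  define D where "D = (\<lambda>z. (\<Sum>x\<in>proper_indices a. c1 x * h (division_point t a x - z)) +
     (\<Sum>x\<in>proper_indices b. c2 x * h (division_point t b x - z)))"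
  define DF where "DF = (\<Sum>x\<in>proper_indices a. fps_const (c1 x) * T (division_point t a x)) +
     (\<Sum>x\<in>proper_indices b. fps_const (c2 x) * T (division_point t b x))"
  have D: "D has_fps_expansion DF" unfolding D_def DF_def T_def
    by (intro fps_expansion_intros h.reflected_has_fps_expansion division_point_notin t)
  define UV where "UV = Abs_fps (\<lambda>n. ?a ^ n * fps_nth U n) * Abs_fps (\<lambda>n. ?b ^ n * fps_nth V n)"
  \<comment> \<open>The expansion multiplied by ab z^2, with z^2 h' replaced through
    \<open>pole_cleared_deriv\<close>; the left side becomes u(az) v(bz), so both sides are power
    series.\<close>
  define R where "R = fps_const (- (?a * ?b)) * (fps_X\<^sup>2 * DF) - fps_X * fps_deriv W + W"
  have UV: "(\<lambda>z. ?u (?a * z) * ?v (?b * z)) has_fps_expansion UV" unfolding UV_def U_def V_def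
    by (intro has_fps_expansion_mult has_fps_expansion_scale f.pole_cleared_fps g.pole_cleared_fps)
  have R: "(\<lambda>z. - (?a * ?b) * (z\<^sup>2 * D z) - z * deriv ?w z + ?w z) has_fps_expansion R"
    unfolding R_def W_def by (intro fps_expansion_intros D h.pole_cleared_fps)
  have "eventually (\<lambda>z. ?u (?a * z) * ?v (?b * z) = - (?a * ?b) * (z\<^sup>2 * D z) - z * deriv ?w z + ?w z) (at 0)"
    using product_partial_fractions[OF f g h ab sgn] eventually_notin_period_lattice[OF t, of 0 0]
      eventually_neq_at_within[of 0 0 UNIV]
  proof eventually_elim
    case (elim z)
    have "f (?a * z) * g (?b * z) = - D z - 1 / (?a * ?b) * deriv h z"
      using elim(1) by (simp add: D_def c1_def c2_def case_prod_unfold)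
    then have "?a * ?b * z\<^sup>2 * (f (?a * z) * g (?b * z)) = ?a * ?b * z\<^sup>2 * (- D z - 1 / (?a * ?b) * deriv h z)"
      by (simp only:)
    also have "\<dots> = - (?a * ?b) * (z\<^sup>2 * D z) - z\<^sup>2 * deriv h z"
      using ab by (simp add: field_simps)
    finally have "?a * ?b * z\<^sup>2 * (f (?a * z) * g (?b * z)) = - (?a * ?b) * (z\<^sup>2 * D z) - z\<^sup>2 * deriv h z" .
    moreover have "?a * ?b * z\<^sup>2 * (f (?a * z) * g (?b * z)) = ?u (?a * z) * ?v (?b * z)"
      using ab elim(3) by (simp add: pole_cleared_def power2_eq_square mult_ac)
    ultimately show ?case using h.pole_cleared_deriv[of z] elim(2,3) by simp
  qed
  \<comment> \<open>At z = 0 both sides equal 1, so the punctured neighbourhood can be filled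
    in.\<close>
  then have "eventually (\<lambda>z. ?u (?a * z) * ?v (?b * z) = - (?a * ?b) * (z\<^sup>2 * D z) - z * deriv ?w z + ?w z) (nhds 0)"
    by (simp add: eventually_at_filter pole_cleared_def eventually_mono)
  from iffD1[OF has_fps_expansion_cong[OF this refl] UV] have "UV = R"
    using R by (rule fps_expansion_unique_complex)
  then have eq: "fps_nth UV (2 * (N + 1)) = fps_nth R (2 * (N + 1))" by simp
  let ?F = "\<lambda>k. ?a ^ k * fps_nth U k * (?b ^ (2 * (N + 1) - k) * fps_nth V (2 * (N + 1) - k))"
  have "fps_nth UV (2 * (N + 1)) = (\<Sum>k=0..2 * (N + 1). ?F k)" by (simp add: UV_def fps_mult_nth)
  also have "\<dots> = (\<Sum>s=0..N + 1. ?F (2 * s))"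
    by (rule sum_even_indices) (simp add: U_def f.pole_cleared_fps_odd)
  finally have lhs: "fps_nth UV (2 * (N + 1)) = (\<Sum>s=0..N + 1. ?F (2 * s))" .
  have DFn: "fps_nth DF (2 * N) = (\<Sum>x\<in>proper_indices a. c1 x * ((deriv ^^ (2 * N)) h (division_point t a x) / fact (2 * N))) +
     (\<Sum>x\<in>proper_indices b. c2 x * ((deriv ^^ (2 * N)) h (division_point t b x) / fact (2 * N)))"
    by (simp add: DF_def T_def fps_sum_nth)
  \<comment> \<open>In degree 2N + 2 the part - z w' + w contributes the factor -(2N + 2) + 1, and
    z^2 \<open>D\<close> contributes the coefficient of \<open>D\<close> in degree 2N.\<close>
  have "fps_nth R (2 * (N + 1)) = - (?a * ?b) * fps_nth DF (2 * N) - of_nat (2 * N + 1) * fps_nth W (2 * (N + 1))"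
  proof -
    have "fps_nth (fps_const (- (?a * ?b)) * (fps_X\<^sup>2 * DF)) (2 * (N + 1)) = - (?a * ?b) * fps_nth DF (2 * N)"
      by (simp add: fps_X_power_mult_nth)
    moreover have "fps_nth (fps_X * fps_deriv W) (2 * (N + 1)) = of_nat (2 * (N + 1)) * fps_nth W (2 * (N + 1))"
      by simp
    ultimately show ?thesis
      unfolding R_def fps_add_nth fps_sub_nth by (simp only:) (simp add: algebra_simps)
  qed
  then show ?thesis
    using eq lhs unfolding DFn by (simp add: c1_def c2_def case_prod_unfold diff_mult_distrib2)
qed

theorem theorem4:
  fixes a b i j m n N :: nat and \<tau> :: complex
  assumes "a > 0" and "b > 0" and "coprime a b"
    and "i \<in> {0, 1}" and "j \<in> {0, 1}" and "m \<in> {0, 1}" and "n \<in> {0, 1}"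
    and "(i, j) \<noteq> (0, 0)" and "(m, n) \<noteq> (0, 0)"
    and "\<tau> \<in> Gamma2_domain"
    and "odd (i * a + m * b) \<or> odd (j * a + n * b)"
  shows
    "1 / fact (2 * N) * (1 / of_nat a) *
       (\<Sum>(\<mu>, \<nu>) \<in> {0..<a} \<times> {0..<a} - {(0, 0)}.
          (-1) ^ (i * \<mu> + j * \<nu>) *
          jacobi_f m n (of_nat b * ((of_nat \<mu> * \<tau> + of_nat \<nu>) / of_nat a)) \<tau> *
          jacobi_f_deriv (2 * N) (i * a + m * b) (j * a + n * b)
            ((of_nat \<mu> * \<tau> + of_nat \<nu>) / of_nat a) \<tau>)
     + 1 / fact (2 * N) * (1 / of_nat b) *
       (\<Sum>(\<mu>, \<nu>) \<in> {0..<b} \<times> {0..<b} - {(0, 0)}.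
          (-1) ^ (m * \<mu> + n * \<nu>) *
          jacobi_f i j (of_nat a * ((of_nat \<mu> * \<tau> + of_nat \<nu>) / of_nat b)) \<tau> *
          jacobi_f_deriv (2 * N) (i * a + m * b) (j * a + n * b)
            ((of_nat \<mu> * \<tau> + of_nat \<nu>) / of_nat b) \<tau>)
     = - (\<Sum>s = 0..N + 1. jacobi_C i j s \<tau> * jacobi_C m n (N + 1 - s) \<tau> *
            of_nat a powi (2 * int s - 1) * of_nat b powi (2 * int N + 1 - 2 * int s))
       - 1 / (of_nat a * of_nat b) * of_nat (2 * N + 1) *
           jacobi_C (i * a + m * b) (j * a + n * b) (N + 1) \<tau>"
    (is "?S1 + ?S2 = - ?L - ?R")
proof -
  have t: "Im \<tau> > 0" using assms(10) by (simp add: Gamma2_domain_def)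
  have ij: "odd i \<or> odd j" and mn: "odd m \<or> odd n" using assms(4-9) by auto
  note f = sign_elliptic_jacobi_f[OF t ij] and g = sign_elliptic_jacobi_f[OF t mn]
    and h = sign_elliptic_jacobi_f[OF t assms(11)]
  note C = sign_elliptic.laurent_coefficient_conv_fps[OF f, folded jacobi_C_def]
    sign_elliptic.laurent_coefficient_conv_fps[OF g, folded jacobi_C_def]
    sign_elliptic.laurent_coefficient_conv_fps[OF h, folded jacobi_C_def]
  let ?a = "of_nat a :: complex" and ?b = "of_nat b :: complex"
  have nz: "?a \<noteq> 0" "?b \<noteq> 0" using assms(1,2) by auto
  define X1 where "X1 = (\<Sum>(\<mu>, \<nu>)\<in>proper_indices a. (-1) ^ (i * \<mu> + j * \<nu>) / ?a * jacobi_f m n (?b * division_point \<tau> a (\<mu>, \<nu>)) \<tau> *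
           ((deriv ^^ (2 * N)) (\<lambda>z. jacobi_f (i * a + m * b) (j * a + n * b) z \<tau>) (division_point \<tau> a (\<mu>, \<nu>)) / fact (2 * N)))"
  define X2 where "X2 = (\<Sum>(\<mu>, \<nu>)\<in>proper_indices b. (-1) ^ (m * \<mu> + n * \<nu>) / ?b * jacobi_f i j (?a * division_point \<tau> b (\<mu>, \<nu>)) \<tau> *
           ((deriv ^^ (2 * N)) (\<lambda>z. jacobi_f (i * a + m * b) (j * a + n * b) z \<tau>) (division_point \<tau> b (\<mu>, \<nu>)) / fact (2 * N)))"
  have S1: "?S1 = X1"
    unfolding X1_def proper_indices_def jacobi_f_deriv_def sum_distrib_left
    by (intro sum.cong refl) (auto simp: division_point_def)
  have S2: "?S2 = X2"
    unfolding X2_def proper_indices_def jacobi_f_deriv_def sum_distrib_left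
    by (intro sum.cong refl) (auto simp: division_point_def)
  \<comment> \<open>The exponents 2s - 1 and 2N + 1 - 2s reach -1 at s = 0 and s = N + 1; the factor
    ab raises each by one and makes them natural numbers.\<close>
  have L: "?a * ?b * ?L = (\<Sum>s=0..N + 1. ?a ^ (2 * s) * jacobi_C i j s \<tau> *
            (?b ^ (2 * (N + 1 - s)) * jacobi_C m n (N + 1 - s) \<tau>))"
    unfolding sum_distrib_left
  proof (rule sum.cong)
    fix s assume s: "s \<in> {0..N + 1}"
    have "?a * ?a powi (2 * int s - 1) = ?a powi (int (2 * s))"
      using nz by (simp add: power_int_diff)
    moreover have "?b * ?b powi (2 * int N + 1 - 2 * int s) = ?b powi (int (2 * (N + 1 - s)))"
    proof -
      have "int (2 * (N + 1 - s)) = 1 + (2 * int N + 1 - 2 * int s)" using s by (simp add: of_nat_diff)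
      moreover have "?b powi (1 + (2 * int N + 1 - 2 * int s)) = ?b powi 1 * ?b powi (2 * int N + 1 - 2 * int s)"
        using nz by (intro power_int_add) simp
      ultimately show ?thesis by (simp only: power_int_1_right)
    qed
    ultimately have powi: "?a * ?a powi (2 * int s - 1) = ?a ^ (2 * s)"
      "?b * ?b powi (2 * int N + 1 - 2 * int s) = ?b ^ (2 * (N + 1 - s))"
      by (simp_all only: power_int_of_nat)
    have "?a * ?b * (jacobi_C i j s \<tau> * jacobi_C m n (N + 1 - s) \<tau> *
        ?a powi (2 * int s - 1) * ?b powi (2 * int N + 1 - 2 * int s)) =
      (?a * ?a powi (2 * int s - 1)) * jacobi_C i j s \<tau> *
        ((?b * ?b powi (2 * int N + 1 - 2 * int s)) * jacobi_C m n (N + 1 - s) \<tau>)"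
      by (simp only: mult_ac)
    then show "?a * ?b * (jacobi_C i j s \<tau> * jacobi_C m n (N + 1 - s) \<tau> *
        ?a powi (2 * int s - 1) * ?b powi (2 * int N + 1 - 2 * int s)) =
      ?a ^ (2 * s) * jacobi_C i j s \<tau> * (?b ^ (2 * (N + 1 - s)) * jacobi_C m n (N + 1 - s) \<tau>)"
      unfolding powi .
  qed simp
  have "?a * ?b * ?L = - ?a * ?b * (X1 + X2) - of_nat (2 * N + 1) * jacobi_C (i * a + m * b) (j * a + n * b) (N + 1) \<tau>"
    unfolding L unfolding X1_def X2_def C
    by (rule reciprocity_fps[OF f g h assms(1,2,3,11)])
  moreover have "?a * ?b * x = ?a * ?b * (- l - 1 / (?a * ?b) * c * d)" if "?a * ?b * l = - ?a * ?b * x - c * d" for x l c d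
  proof -
    have expand: "?a * ?b * (- l - 1 / (?a * ?b) * c * d) = - (?a * ?b * l) - c * d"
      using nz by (simp add: right_diff_distrib)
    show ?thesis unfolding expand that by simp
  qed
  ultimately have "?a * ?b * (X1 + X2) = ?a * ?b * (- ?L - ?R)" by blast
  then show ?thesis unfolding S1 S2 using nz by (simp only: mult_cancel_left) simp
qed

end
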